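(* Let $(\mathcal{M},\tau)$ be a tracial $W^*$-probability space and $N\in\mathbb{N}$. For every $a_1,\dots,a_N\in\mathcal{M}^{sa}$ and $R>0$, $$\eta_R(a_1,\dots,a_N)\ge\tilde\eta_R(a_1,\dots,a_N)=\chi_R(a_1,\dots,a_N),$$ $$\eta(a_1,\dots,a_N)\ge\tilde\eta(a_1,\dots,a_N)=\chi(a_1,\dots,a_N).$$
   Context: A tracial $W^*$-probability space $(\mathcal{M},\tau)$ is a von Neumann algebra $\mathcal{M}$ with a faithful normal tracial state $\tau$; $\mathcal{M}^{sa}$ is the set of selfadjoint elements. $M_n$ is the algebra of $n\times n$ complex matrices, $M_n^{sa}$ its selfadjoint part, $\mathrm{tr}_n$ the normalized trace, $\|\cdot\|$ the operator norm, $(M_n^{sa})_R:=\{A\in M_n^{sa}:\|A\|\le R\}$ and $(M_n^{sa})_R^N$ its $N$-fold Cartesian product. $\Lambda_n$ is the measure $d\Lambda_n(A):=2^{n(n-1)/2}\prod_{i=1}^n dA_{ii}\prod_{i<j}d(\mathrm{Re}\,A_{ij})\,d(\mathrm{Im}\,A_{ij})$ on $M_n^{sa}$, and $\Lambda_n^{\otimes N}$ is its $N$-fold product. Convention: $\log 0=-\infty$. $\mathbb{C}\langle X_1,\dots,X_N\rangle$ is the noncommutative polynomial $*$-algebra with $X_i^*=X_i$, and $\mathbb{C}\langle X_1,\dots,X_N\rangle^{sa}$ its selfadjoint part. For $p\in\mathbb{C}\langle X_1,\dots,X_N\rangle^{sa}$ and $R>0$ the free pressure is $$\pi_R(p):=\limsup_{n\to\infty}\Bigl(\frac1{n^2}\log\int_{(M_n^{sa})_R^N}\exp\bigl(-n^2\mathrm{tr}_n(p(A_1,\dots,A_N))\bigr)\,d\Lambda_n^{\otimes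 N}(A_1,\dots,A_N)+\frac N2\log n\Bigr).$$ For $a_1,\dots,a_N\in\mathcal{M}^{sa}$, $$\eta_R(a_1,\dots,a_N):=\inf\{\tau(p(a_1,\dots,a_N))+\pi_R(p):p\in\mathbb{C}\langle X_1,\dots,X_N\rangle^{sa}\},\quad \eta(a_1,\dots,a_N):=\sup_{R>0}\eta_R(a_1,\dots,a_N).$$ Tensor version: consider the algebraic tensor product $*$-algebra $\mathbb{C}\langle X_1,\dots,X_N\rangle\otimes\mathbb{C}\langle X_1,\dots,X_N\rangle$ with $(p_1\otimes p_2)^*=p_1^*\otimes p_2^*$. For $q=\sum c_{i_1\dots i_k,j_1\dots j_l}X_{i_1}\cdots X_{i_k}\otimes X_{j_1}\cdots X_{j_l}$ and selfadjoint operators $a_1,\dots,a_N$ put $q(a_1,\dots,a_N):=\sum c_{i_1\dots i_k,j_1\dots j_l}a_{i_1}\cdots a_{i_k}\otimes a_{j_1}\cdots a_{j_l}$. For selfadjoint $q$ and $R>0$, $$\pi_R^{(2)}(q):=\limsup_{n\to\infty}\Bigl(\frac1{n^2}\log\int_{(M_n^{sa})_R^N}\exp\bigl(-n^2(\mathrm{tr}_n\otimes\mathrm{tr}_n)(q(A_1,\dots,A_N))\bigr)\,d\Lambda_n^{\otimes N}+\frac N2\log n\Bigr).$$ For a selfadjoint linear functional $\nu$ on $\mathbb{C}\langle X_1,\dots,X_N\rangle\otimes\mathbb{C}\langle X_1,\dots,X_N\rangle$ with $\nu(\mathbf 1)=1$, $$\eta_R^{(2)}(\nu):=\inf\{\nu(q)+\pi_R^{(2)}(q):q\in(\mathbb{C}\langle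 X_1,\dots,X_N\rangle\otimes\mathbb{C}\langle X_1,\dots,X_N\rangle)^{sa}\}.$$ With $\mu_{(a_1,\dots,a_N)}(p):=\tau(p(a_1,\dots,a_N))$ for $p\in\mathbb{C}\langle X_1,\dots,X_N\rangle$, define $\tilde\eta_R(a_1,\dots,a_N):=\eta_R^{(2)}(\mu_{(a_1,\dots,a_N)}\otimes\mu_{(a_1,\dots,a_N)})$ and $\tilde\eta(a_1,\dots,a_N):=\sup_{R>0}\tilde\eta_R(a_1,\dots,a_N)$. Voiculescu's microstate free entropy: let $\Gamma_R(a_1,\dots,a_N;n,r,\varepsilon)$ be the set of $(A_1,\dots,A_N)\in(M_n^{sa})^N$ with $\|A_i\|\le R$ and $|\mathrm{tr}_n(A_{i_1}\cdots A_{i_k})-\tau(a_{i_1}\cdots a_{i_k})|\le\varepsilon$ for all $1\le i_1,\dots,i_k\le N$, $k\le r$. Then $$\chi_R(a_1,\dots,a_N):=\lim_{r\to\infty,\,\varepsilon\to+0}\limsup_{n\to\infty}\Bigl(\frac1{n^2}\log\Lambda_n^{\otimes N}(\Gamma_R(a_1,\dots,a_N;n,r,\varepsilon))+\frac N2\log n\Bigr),$$ and $\chi(a_1,\dots,a_N):=\sup_{R>0}\chi_R(a_1,\dots,a_N)$. *)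

theory Defs
  imports
    "HOL-Probability.Probability"
    "HOL-Library.Poly_Mapping"
    "HOL-Library.Product_Plus"
    "Jordan_Normal_Form.Schur_Decomposition"
begin

section \<open>Complex Hilbert spaces and von Neumann algebras\<close>

text \<open>The inner product is linear in the first argument. Positive definiteness is inherited
  from \<^class>\<open>real_inner\<close>, whose inner product is the real part.\<close>

class complex_hilbert = real_inner + complete_space +
  fixes scaleC :: "complex \<Rightarrow> 'a \<Rightarrow> 'a" (infixr \<open>*\<^sub>C\<close> 75)
    and cinner :: "'a \<Rightarrow> 'a \<Rightarrow> complex"
  assumes scaleC_add_right: "c *\<^sub>C (x + y) = c *\<^sub>C x + c *\<^sub>C y"
    and scaleC_add_left: "(c + d) *\<^sub>C x = c *\<^sub>C x + d *\<^sub>C x"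
    and scaleC_scaleC: "c *\<^sub>C d *\<^sub>C x = (c * d) *\<^sub>C x"
    and scaleC_of_real: "complex_of_real r *\<^sub>C x = r *\<^sub>R x"
    and cinner_commute: "cinner x y = cnj (cinner y x)"
    and cinner_add_left: "cinner (x + y) z = cinner x z + cinner y z"
    and cinner_scaleC_left: "cinner (c *\<^sub>C x) y = c * cinner x y"
    and Re_cinner: "Re (cinner x y) = inner x y"

instantiation complex :: complex_hilbert
begin

definition scaleC_complex :: "complex \<Rightarrow> complex \<Rightarrow> complex"
  where "scaleC_complex c x = c * x"

definition cinner_complex :: "complex \<Rightarrow> complex \<Rightarrow> complex"
  where "cinner_complex x y = x * cnj y"

instance
  by standard
    (auto simp: scaleC_complex_def cinner_complex_def algebra_simps scaleR_conv_of_real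
      inner_complex_def)

end

lemma norm_scaleC: "norm (c *\<^sub>C x) = cmod c * norm (x :: 'h :: complex_hilbert)"
proof -
  have self: "cinner z z = complex_of_real ((norm z)\<^sup>2)" for z :: 'h
  proof (rule complex_eqI)
    show "Re (cinner z z) = Re (complex_of_real ((norm z)\<^sup>2))"
      by (simp add: Re_cinner power2_norm_eq_inner)
    have "Im (cinner z z) = - Im (cinner z z)"
      using arg_cong[OF cinner_commute[of z z], of Im] by simp
    then show "Im (cinner z z) = Im (complex_of_real ((norm z)\<^sup>2))" by simp
  qed
  have "cinner (c *\<^sub>C x) (c *\<^sub>C x) = c * cnj (c * cinner x x)"
    by (metis cinner_commute cinner_scaleC_left)
  then have "complex_of_real ((norm (c *\<^sub>C x))\<^sup>2) = (c * cnj c) * complex_of_real ((norm x)\<^sup>2)"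
    by (simp add: self)
  also have "\<dots> = complex_of_real ((cmod c * norm x)\<^sup>2)"
    by (simp add: complex_norm_square[symmetric] power_mult_distrib)
  finally have "(norm (c *\<^sub>C x))\<^sup>2 = (cmod c * norm x)\<^sup>2"
    using of_real_eq_iff by blast
  then show ?thesis by (simp add: power2_eq_iff_nonneg)
qed

text \<open>Elements of \<^typ>\<open>'h \<Rightarrow>\<^sub>L 'h\<close> are only real-linear; \<open>bounded_ops\<close> is $B(H)$.\<close>

definition bounded_ops :: "('h :: complex_hilbert \<Rightarrow>\<^sub>L 'h) set"
  where "bounded_ops = {A. \<forall>c x. blinfun_apply A (c *\<^sub>C x) = c *\<^sub>C blinfun_apply A x}"

lift_definition scale_op ::
    "complex \<Rightarrow> ('h :: complex_hilbert \<Rightarrow>\<^sub>L 'h) \<Rightarrow> ('h \<Rightarrow>\<^sub>L 'h)"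
  is "\<lambda>c A x. c *\<^sub>C A x"
proof -
  fix c and A :: "'h \<Rightarrow> 'h" assume A: "bounded_linear A"
  show "bounded_linear (\<lambda>x. c *\<^sub>C A x)"
  proof (rule bounded_linear_intro)
    show "c *\<^sub>C A (x + y) = c *\<^sub>C A x + c *\<^sub>C A y" for x y
      by (simp add: bounded_linear.linear[OF A] linear_add scaleC_add_right)
    show "c *\<^sub>C A (r *\<^sub>R x) = r *\<^sub>R c *\<^sub>C A x" for r x
    proof -
      have "c *\<^sub>C A (r *\<^sub>R x) = c *\<^sub>C complex_of_real r *\<^sub>C A x"
        by (simp only: linear_scale[OF bounded_linear.linear[OF A]] scaleC_of_real)
      also have "\<dots> = complex_of_real r *\<^sub>C c *\<^sub>C A x"
        by (simp only: scaleC_scaleC mult.commute)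
      finally show ?thesis by (simp only: scaleC_of_real)
    qed
    show "norm (c *\<^sub>C A x) \<le> norm x * (onorm A * cmod c)" for x
      using mult_left_mono[OF onorm[OF A, of x], of "cmod c"]
      by (simp add: norm_scaleC mult.commute mult.left_commute)
  qed
qed

definition is_adjoint :: "('h :: complex_hilbert \<Rightarrow>\<^sub>L 'h) \<Rightarrow> ('h \<Rightarrow>\<^sub>L 'h) \<Rightarrow> bool"
  where "is_adjoint A B \<longleftrightarrow>
    (\<forall>x y. cinner (blinfun_apply A x) y = cinner x (blinfun_apply B y))"

definition commutant :: "('h :: complex_hilbert \<Rightarrow>\<^sub>L 'h) set \<Rightarrow> ('h \<Rightarrow>\<^sub>L 'h) set"
  where "commutant S = {T \<in> bounded_ops. \<forall>A\<in>S. T o\<^sub>L A = A o\<^sub>L T}"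

text \<open>A self-adjoint subset of $B(H)$ that equals its bicommutant; every commutant is a unital
  subalgebra, so the algebra axioms need not be listed.\<close>

definition von_neumann_algebra :: "('h :: complex_hilbert \<Rightarrow>\<^sub>L 'h) set \<Rightarrow> bool"
  where "von_neumann_algebra M \<longleftrightarrow>
    M \<subseteq> bounded_ops \<and> (\<forall>A\<in>M. \<exists>B\<in>M. is_adjoint A B) \<and> commutant (commutant M) = M"

definition selfadjoints :: "('h :: complex_hilbert \<Rightarrow>\<^sub>L 'h) set \<Rightarrow> ('h \<Rightarrow>\<^sub>L 'h) set"
  where "selfadjoints M = {A \<in> M. is_adjoint A A}"

definition op_le :: "('h :: complex_hilbert \<Rightarrow>\<^sub>L 'h) \<Rightarrow> ('h \<Rightarrow>\<^sub>L 'h) \<Rightarrow> bool"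
  where "op_le A B \<longleftrightarrow>
    (\<forall>x. Re (cinner (blinfun_apply A x) x) \<le> Re (cinner (blinfun_apply B x) x))"

definition is_op_lub ::
    "('h :: complex_hilbert \<Rightarrow>\<^sub>L 'h) set \<Rightarrow> ('h \<Rightarrow>\<^sub>L 'h) set \<Rightarrow> ('h \<Rightarrow>\<^sub>L 'h) \<Rightarrow> bool"
  where "is_op_lub M D S \<longleftrightarrow> S \<in> selfadjoints M \<and> (\<forall>A\<in>D. op_le A S) \<and>
    (\<forall>T\<in>selfadjoints M. (\<forall>A\<in>D. op_le A T) \<longrightarrow> op_le S T)"

text \<open>Functionals on \<open>M\<close> are total functions whose values outside \<open>M\<close> are irrelevant. In
  \<open>normal\<close>, the supremum is over a nonempty set bounded above by the value at \<open>S\<close>.\<close>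

locale tracial_W_star_probability_space =
  fixes M :: "('h :: complex_hilbert \<Rightarrow>\<^sub>L 'h) set"
    and \<tau> :: "('h \<Rightarrow>\<^sub>L 'h) \<Rightarrow> complex"
  assumes von_neumann: "von_neumann_algebra M"
    and add: "\<lbrakk>A \<in> M; B \<in> M\<rbrakk> \<Longrightarrow> \<tau> (A + B) = \<tau> A + \<tau> B"
    and scale: "A \<in> M \<Longrightarrow> \<tau> (scale_op c A) = c * \<tau> A"
    and positive: "\<lbrakk>A \<in> M; B \<in> M; is_adjoint A B\<rbrakk> \<Longrightarrow> Im (\<tau> (B o\<^sub>L A)) = 0 \<and> 0 \<le> Re (\<tau> (B o\<^sub>L A))"
    and unital: "\<tau> id_blinfun = 1"
    and faithful: "\<lbrakk>A \<in> M; B \<in> M; is_adjoint A B; \<tau> (B o\<^sub>L A) = 0\<rbrakk> \<Longrightarrow> A = 0"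
    and normal: "\<lbrakk>D \<subseteq> selfadjoints M; D \<noteq> {};
        \<And>A B. \<lbrakk>A \<in> D; B \<in> D\<rbrakk> \<Longrightarrow> \<exists>C\<in>D. op_le A C \<and> op_le B C;
        is_op_lub M D S\<rbrakk> \<Longrightarrow> Re (\<tau> S) = (SUP A\<in>D. Re (\<tau> A))"
    and tracial: "\<lbrakk>A \<in> M; B \<in> M\<rbrakk> \<Longrightarrow> \<tau> (A o\<^sub>L B) = \<tau> (B o\<^sub>L A)"


section \<open>Noncommutative polynomials\<close>

text \<open>The variables are indexed by a finite type \<^typ>\<open>'n\<close>, so $N$ is \<^term>\<open>CARD('n)\<close>. Lists are
  the free monoid, written additively because \<^typ>\<open>'a \<Rightarrow>\<^sub>0 'b\<close> then carries the convolution
  product; this makes \<open>ncpoly\<close> the free algebra, and \<open>ncpoly2\<close> its algebraic tensor square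
  with the pair \<open>(u, v)\<close> standing for $X_u \otimes X_v$.\<close>

instantiation list :: (type) monoid_add
begin

definition zero_list :: "'a list" where "zero_list = []"

definition plus_list :: "'a list \<Rightarrow> 'a list \<Rightarrow> 'a list" where "plus_list u v = u @ v"

instance
  by standard (simp_all add: zero_list_def plus_list_def)

end

type_synonym 'n ncpoly = "'n list \<Rightarrow>\<^sub>0 complex"
type_synonym 'n ncpoly2 = "('n list \<times> 'n list) \<Rightarrow>\<^sub>0 complex"

definition star :: "'n ncpoly \<Rightarrow> 'n ncpoly"
  where "star p = Poly_Mapping.map_key rev (Poly_Mapping.map cnj p)"

definition star2 :: "'n ncpoly2 \<Rightarrow> 'n ncpoly2"
  where "star2 q = Poly_Mapping.map_key (map_prod rev rev) (Poly_Mapping.map cnj q)"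

lemma lookup_star: "Poly_Mapping.lookup (star p) u = cnj (Poly_Mapping.lookup p (rev u))"
  by (simp add: star_def map_key.rep_eq Poly_Mapping.map.rep_eq when_def)

lemma lookup_star2:
  "Poly_Mapping.lookup (star2 q) (u, v) = cnj (Poly_Mapping.lookup q (rev u, rev v))"
proof -
  have "inj (map_prod rev rev :: 'a list \<times> 'a list \<Rightarrow> _)"
    by (intro prod.inj_map) simp_all
  then show ?thesis
    by (simp add: star2_def map_key.rep_eq Poly_Mapping.map.rep_eq when_def)
qed

definition ncpoly_sa :: "'n ncpoly set" where "ncpoly_sa = {p. star p = p}"

definition ncpoly2_sa :: "'n ncpoly2 set" where "ncpoly2_sa = {q. star2 q = q}"

definition tensor_functional ::
    "('n ncpoly \<Rightarrow> complex) \<Rightarrow> ('n ncpoly \<Rightarrow> complex) \<Rightarrow> 'n ncpoly2 \<Rightarrow> complex"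
  where "tensor_functional \<phi> \<psi> q =
    (\<Sum>(u, v)\<in>Poly_Mapping.keys q. Poly_Mapping.lookup q (u, v) *
      (\<phi> (Poly_Mapping.single u 1) * \<psi> (Poly_Mapping.single v 1)))"

definition word_op ::
    "('n \<Rightarrow> ('h :: complex_hilbert \<Rightarrow>\<^sub>L 'h)) \<Rightarrow> 'n list \<Rightarrow> ('h \<Rightarrow>\<^sub>L 'h)"
  where "word_op a w = foldr (\<lambda>i T. a i o\<^sub>L T) w id_blinfun"

definition eval_op ::
    "'n ncpoly \<Rightarrow> ('n \<Rightarrow> ('h :: complex_hilbert \<Rightarrow>\<^sub>L 'h)) \<Rightarrow> ('h \<Rightarrow>\<^sub>L 'h)"
  where "eval_op p a =
    (\<Sum>w\<in>Poly_Mapping.keys p. scale_op (Poly_Mapping.lookup p w) (word_op a w))"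

definition distribution ::
    "(('h :: complex_hilbert \<Rightarrow>\<^sub>L 'h) \<Rightarrow> complex) \<Rightarrow> ('n \<Rightarrow> ('h \<Rightarrow>\<^sub>L 'h)) \<Rightarrow> 'n ncpoly \<Rightarrow> complex"
  where "distribution \<tau> a p = \<tau> (eval_op p a)"


section \<open>Matrices\<close>

definition herm_mats :: "nat \<Rightarrow> complex mat set"
  where "herm_mats n = {A \<in> carrier_mat n n. mat_adjoint A = A}"

definition ntrace :: "nat \<Rightarrow> complex mat \<Rightarrow> complex"
  where "ntrace n A = (\<Sum>i<n. A $$ (i, i)) / of_nat n"

definition euclid_norm :: "complex vec \<Rightarrow> real"
  where "euclid_norm v = sqrt (Re (v \<bullet>c v))"

definition mat_opnorm :: "complex mat \<Rightarrow> real"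
  where "mat_opnorm A =
    (SUP v\<in>{v \<in> carrier_vec (dim_col A). euclid_norm v \<le> 1}. euclid_norm (A *\<^sub>v v))"

definition word_mat :: "nat \<Rightarrow> ('n \<Rightarrow> complex mat) \<Rightarrow> 'n list \<Rightarrow> complex mat"
  where "word_mat n A w = foldr (\<lambda>i B. A i * B) w (1\<^sub>m n)"

definition eval_mat :: "nat \<Rightarrow> 'n ncpoly \<Rightarrow> ('n \<Rightarrow> complex mat) \<Rightarrow> complex mat"
  where "eval_mat n p A = mat n n (\<lambda>ij.
    \<Sum>w\<in>Poly_Mapping.keys p. Poly_Mapping.lookup p w * word_mat n A w $$ ij)"

text \<open>$(\mathrm{tr}_n \otimes \mathrm{tr}_n)(q(A))$, where $q(A)$ is the combination of the
  $A_u \otimes A_v$ with the coefficients of $q$.\<close>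

definition ntrace2_eval :: "nat \<Rightarrow> 'n ncpoly2 \<Rightarrow> ('n \<Rightarrow> complex mat) \<Rightarrow> complex"
  where "ntrace2_eval n q A =
    (\<Sum>(u, v)\<in>Poly_Mapping.keys q. Poly_Mapping.lookup q (u, v) *
      (ntrace n (word_mat n A u) * ntrace n (word_mat n A v)))"

text \<open>The real coordinates of a hermitian matrix: \<open>x (i, i)\<close> is the diagonal entry, and for
  \<open>i < j\<close> the numbers \<open>x (i, j)\<close> and \<open>x (j, i)\<close> are the real and the imaginary part of
  entry \<open>(i, j)\<close>.\<close>

definition herm_of_coords :: "nat \<Rightarrow> (nat \<times> nat \<Rightarrow> real) \<Rightarrow> complex mat"
  where "herm_of_coords n x = mat n n (\<lambda>(i, j).
    if i = j then complex_of_real (x (i, i))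
    else if i < j then Complex (x (i, j)) (x (j, i))
    else Complex (x (j, i)) (- x (i, j)))"

definition Lambda :: "nat \<Rightarrow> complex mat measure"
  where "Lambda n = scale_measure (2 ^ (n * (n - 1) div 2))
    (embed_measure (Pi\<^sub>M ({..<n} \<times> {..<n}) (\<lambda>_. lborel)) (herm_of_coords n))"

definition Lambda_power :: "nat \<Rightarrow> ('n :: finite \<Rightarrow> complex mat) measure"
  where "Lambda_power n = Pi\<^sub>M UNIV (\<lambda>_. Lambda n)"

definition mat_ball :: "nat \<Rightarrow> real \<Rightarrow> ('n :: finite \<Rightarrow> complex mat) set"
  where "mat_ball n R = {A. \<forall>i. A i \<in> herm_mats n \<and> mat_opnorm (A i) \<le> R}"

lemma inj_on_herm_of_coords:
  "inj_on (herm_of_coords n) (space (Pi\<^sub>M ({..<n} \<times> {..<n}) (\<lambda>_. lborel)))"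
proof (rule inj_onI)
  fix x y :: "nat \<times> nat \<Rightarrow> real"
  assume x: "x \<in> space (Pi\<^sub>M ({..<n} \<times> {..<n}) (\<lambda>_. lborel))"
    and y: "y \<in> space (Pi\<^sub>M ({..<n} \<times> {..<n}) (\<lambda>_. lborel))"
    and eq: "herm_of_coords n x = herm_of_coords n y"
  have ent: "herm_of_coords n x $$ (i, j) = herm_of_coords n y $$ (i, j)" for i j
    using eq by simp
  have "x (i, j) = y (i, j)" if "i < n" "j < n" for i j
    using ent[of i j] ent[of j i] that
    by (auto simp: herm_of_coords_def complex_eq_iff split: if_splits)
  with x y show "x = y"
    by (intro PiE_ext[of x "{..<n} \<times> {..<n}" "\<lambda>_. UNIV" y]) (auto simp: space_PiM)
qed

lemma herm_mats_iff:
  "A \<in> herm_mats n \<longleftrightarrow>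
    A \<in> carrier_mat n n \<and> (\<forall>i<n. \<forall>j<n. A $$ (i, j) = cnj (A $$ (j, i)))"
proof -
  have *: "mat_adjoint A = mat n n (\<lambda>(i, j). cnj (A $$ (j, i)))" if "A \<in> carrier_mat n n"
    using that unfolding mat_adjoint_def by (intro eq_matI) (auto simp: mat_of_rows_def)
  show ?thesis
  proof (cases "A \<in> carrier_mat n n")
    case True
    then have "mat_adjoint A = A \<longleftrightarrow> (\<forall>i<n. \<forall>j<n. cnj (A $$ (j, i)) = A $$ (i, j))"
      by (simp add: *[OF True] mat_eq_iff[of _ A])
    with True show ?thesis
      by (simp add: herm_mats_def eq_commute[of "A $$ _"])
  qed (simp add: herm_mats_def)
qed

lemma space_Lambda: "space (Lambda n) = herm_mats n"
proof -
  have "herm_of_coords n ` (({..<n} \<times> {..<n}) \<rightarrow>\<^sub>E UNIV) = herm_mats n"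
  proof (intro equalityI subsetI)
    fix A assume "A \<in> herm_of_coords n ` (({..<n} \<times> {..<n}) \<rightarrow>\<^sub>E UNIV)"
    then obtain x where A: "A = herm_of_coords n x" by blast
    have "A $$ (i, j) = cnj (A $$ (j, i))" if "i < n" "j < n" for i j
      using that unfolding A
      by (cases i j rule: linorder_cases) (simp_all add: herm_of_coords_def complex_eq_iff)
    moreover have "A \<in> carrier_mat n n"
      by (simp add: A herm_of_coords_def)
    ultimately show "A \<in> herm_mats n"
      unfolding herm_mats_iff by blast
  next
    fix A assume A: "A \<in> herm_mats n"
    let ?x = "restrict (\<lambda>(i, j). if i \<le> j then Re (A $$ (i, j)) else Im (A $$ (j, i)))
      ({..<n} \<times> {..<n})"
    have h: "A $$ (i, j) = cnj (A $$ (j, i))" if "i < n" "j < n" for i j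
      using A that unfolding herm_mats_iff by blast
    have dim: "dim_row A = n" "dim_col A = n"
      using A unfolding herm_mats_iff by blast+
    have "A = herm_of_coords n ?x"
    proof (rule eq_matI)
      fix i j assume "i < dim_row (herm_of_coords n ?x)" "j < dim_col (herm_of_coords n ?x)"
      then have ij: "i < n" "j < n" by (simp_all add: herm_of_coords_def)
      show "A $$ (i, j) = herm_of_coords n ?x $$ (i, j)"
        using ij h[OF ij]
        by (cases i j rule: linorder_cases) (simp_all add: herm_of_coords_def complex_eq_iff)
    qed (use dim in \<open>simp_all add: herm_of_coords_def\<close>)
    moreover have "?x \<in> ({..<n} \<times> {..<n}) \<rightarrow>\<^sub>E UNIV"
      by (simp add: Pi_iff)
    ultimately show "A \<in> herm_of_coords n ` (({..<n} \<times> {..<n}) \<rightarrow>\<^sub>E UNIV)"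
      by (rule image_eqI)
  qed
  then show ?thesis
    by (simp add: Lambda_def space_scale_measure space_embed_measure space_PiM)
qed


section \<open>Free pressure and free entropies\<close>

definition log_ennreal :: "ennreal \<Rightarrow> ereal"
  where "log_ennreal x =
    (if x = 0 then -\<infinity> else if x = \<infinity> then \<infinity> else ereal (ln (enn2real x)))"

definition growth_rate :: "nat \<Rightarrow> (nat \<Rightarrow> ennreal) \<Rightarrow> ereal"
  where "growth_rate N V = limsup (\<lambda>n.
    ereal (1 / (real n)\<^sup>2) * log_ennreal (V n) + ereal (real N / 2 * ln (real n)))"

text \<open>For self-adjoint \<open>p\<close> and \<open>q\<close> the traces and the values of \<open>\<tau>\<close> below are real numbers.\<close>

definition pressure :: "real \<Rightarrow> 'n :: finite ncpoly \<Rightarrow> ereal"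
  where "pressure R p = growth_rate CARD('n) (\<lambda>n.
    \<integral>\<^sup>+A\<in>mat_ball n R. ennreal (exp (- (real n)\<^sup>2 * Re (ntrace n (eval_mat n p A))))
      \<partial>Lambda_power n)"

definition pressure2 :: "real \<Rightarrow> 'n :: finite ncpoly2 \<Rightarrow> ereal"
  where "pressure2 R q = growth_rate CARD('n) (\<lambda>n.
    \<integral>\<^sup>+A\<in>mat_ball n R. ennreal (exp (- (real n)\<^sup>2 * Re (ntrace2_eval n q A)))
      \<partial>Lambda_power n)"

definition eta_R ::
    "real \<Rightarrow> (('h :: complex_hilbert \<Rightarrow>\<^sub>L 'h) \<Rightarrow> complex) \<Rightarrow> ('n :: finite \<Rightarrow> ('h \<Rightarrow>\<^sub>L 'h)) \<Rightarrow> ereal"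
  where "eta_R R \<tau> a = (INF p\<in>ncpoly_sa. ereal (Re (\<tau> (eval_op p a))) + pressure R p)"

definition eta ::
    "(('h :: complex_hilbert \<Rightarrow>\<^sub>L 'h) \<Rightarrow> complex) \<Rightarrow> ('n :: finite \<Rightarrow> ('h \<Rightarrow>\<^sub>L 'h)) \<Rightarrow> ereal"
  where "eta \<tau> a = (SUP R\<in>{0<..}. eta_R R \<tau> a)"

definition eta2_R :: "real \<Rightarrow> ('n :: finite ncpoly2 \<Rightarrow> complex) \<Rightarrow> ereal"
  where "eta2_R R \<nu> = (INF q\<in>ncpoly2_sa. ereal (Re (\<nu> q)) + pressure2 R q)"

definition eta_tilde_R ::
    "real \<Rightarrow> (('h :: complex_hilbert \<Rightarrow>\<^sub>L 'h) \<Rightarrow> complex) \<Rightarrow> ('n :: finite \<Rightarrow> ('h \<Rightarrow>\<^sub>L 'h)) \<Rightarrow> ereal"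
  where "eta_tilde_R R \<tau> a =
    eta2_R R (tensor_functional (distribution \<tau> a) (distribution \<tau> a))"

definition eta_tilde ::
    "(('h :: complex_hilbert \<Rightarrow>\<^sub>L 'h) \<Rightarrow> complex) \<Rightarrow> ('n :: finite \<Rightarrow> ('h \<Rightarrow>\<^sub>L 'h)) \<Rightarrow> ereal"
  where "eta_tilde \<tau> a = (SUP R\<in>{0<..}. eta_tilde_R R \<tau> a)"

definition microstates ::
    "real \<Rightarrow> (('h :: complex_hilbert \<Rightarrow>\<^sub>L 'h) \<Rightarrow> complex) \<Rightarrow> ('n :: finite \<Rightarrow> ('h \<Rightarrow>\<^sub>L 'h)) \<Rightarrow>
      nat \<Rightarrow> nat \<Rightarrow> real \<Rightarrow> ('n \<Rightarrow> complex mat) set"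
  where "microstates R \<tau> a n r \<epsilon> = {A \<in> mat_ball n R.
    \<forall>w. 1 \<le> length w \<and> length w \<le> r \<longrightarrow>
      cmod (ntrace n (word_mat n A w) - \<tau> (word_op a w)) \<le> \<epsilon>}"

definition chi_R ::
    "real \<Rightarrow> (('h :: complex_hilbert \<Rightarrow>\<^sub>L 'h) \<Rightarrow> complex) \<Rightarrow> ('n :: finite \<Rightarrow> ('h \<Rightarrow>\<^sub>L 'h)) \<Rightarrow> ereal"
  where "chi_R R \<tau> a = Lim (sequentially \<times>\<^sub>F at_right 0) (\<lambda>(r, \<epsilon>).
    growth_rate CARD('n) (\<lambda>n. emeasure (Lambda_power n) (microstates R \<tau> a n r \<epsilon>)))"

definition chi ::
    "(('h :: complex_hilbert \<Rightarrow>\<^sub>L 'h) \<Rightarrow> complex) \<Rightarrow> ('n :: finite \<Rightarrow> ('h \<Rightarrow>\<^sub>L 'h)) \<Rightarrow> ereal"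
  where "chi \<tau> a = (SUP R\<in>{0<..}. chi_R R \<tau> a)"

end

theory Submission
  imports Defs "HOL-Real_Asymp.Real_Asymp"
begin

text \<open>All entropies are compared through upper bounds $e^{n^2(c - (N/2)\log n)}$ on the underlying
  integrals. A test polynomial $q$ is nearly constant on small microstate spaces, which gives
  $\chi_R \le \tilde\eta_R$. Conversely, sums of the
  squared moment deviations $|\mathrm{tr}_n(A_w) - \tau(a_w)|^2$ are of the form
  $(\mathrm{tr}_n \otimes \mathrm{tr}_n)(q(A))$ --- this is what the tensor version makes possible ---
  and large multiples of them concentrate the integral on the microstates, since the rate of the
  volume of the whole ball is finite. The map $p \mapsto p \otimes 1$ embeds the
  test polynomials of $\eta_R$ into those of $\tilde\eta_R$.\<close>

section \<open>Exponential growth rates\<close>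

text \<open>Since \<open>growth_rate\<close> is a limsup of extended reals that may equal
  -\<infinity>, an inequality y \<le> x is tested only against real c > x; each such c turns the
  limsup into an eventual bound free of logarithms. At the scale n^2 a constant factor disappears,
  and a factor e^(n^2 d) shifts the rate by exactly d; these two rules carry all the estimates. The
  traces tr_n(p(A)) are linear in the moments of A, whereas a squared deviation is quadratic in
  them, hence the need for two tensor legs. The quantitative input is an upper bound for the volume
  of the ball. Comparison with a Gaussian of variance 1/n produces the factor n^(-N n^2/2), which is
  what the summand (N/2) log n compensates; the remaining constant N (R^2/2 + log(2 pi)/2 + log 2)
  is not sharp, but any finite value is beaten by a large multiple of the squared
  deviations.\<close>

lemma ereal_le_if_real:
  fixes x y :: ereal
  assumes "\<And>c. x < ereal c \<Longrightarrow> y \<le> ereal c"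
  shows "y \<le> x"
proof (rule dense_ge)
  fix z assume "x < z"
  then obtain c where "x < ereal c" "ereal c < z"
    using ereal_dense2 by blast
  with assms[of c] show "y \<le> z" by auto
qed

text \<open>Removes the logarithm once and for all: the conventions log 0 = -\<infinity> and log
  \<infinity> = \<infinity> are absorbed here. For n = 0 the factor 1/n^2 is 0 by convention, so the
  equivalence is stated for positive n.\<close>

lemma growth_term_le_iff:
  assumes "0 < n"
  shows "ereal (1 / (real n)\<^sup>2) * log_ennreal x + ereal b \<le> ereal c \<longleftrightarrow>
    x \<le> ennreal (exp ((real n)\<^sup>2 * (c - b)))"
proof (cases x)
  case (real y)
  show ?thesis
  proof (cases "y = 0")
    case True
    with real assms show ?thesis by (simp add: log_ennreal_def)
  next
    case False
    with real have y: "0 < y" by simp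
    with real have "ereal (1 / (real n)\<^sup>2) * log_ennreal x = ereal (ln y / (real n)\<^sup>2)"
      by (simp add: log_ennreal_def ennreal_eq_0_iff)
    then have "ereal (1 / (real n)\<^sup>2) * log_ennreal x + ereal b \<le> ereal c \<longleftrightarrow>
        ln y / (real n)\<^sup>2 + b \<le> c"
      by simp
    also have "\<dots> \<longleftrightarrow> ln y \<le> (real n)\<^sup>2 * (c - b)"
      using assms by (simp add: field_simps)
    also have "\<dots> \<longleftrightarrow> y \<le> exp ((real n)\<^sup>2 * (c - b))"
      using y by (metis exp_le_cancel_iff exp_ln)
    finally show ?thesis using real y by (simp add: ennreal_le_iff)
  qed
next
  case top
  with assms show ?thesis by (simp add: log_ennreal_def top_unique)
qed

lemma growth_rate_leI:
  assumes "eventually (\<lambda>n. V n \<le> ennreal (exp ((real n)\<^sup>2 * (c - real N / 2 * ln (real n)))))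
    sequentially"
  shows "growth_rate N V \<le> ereal c"
  unfolding growth_rate_def
proof (rule Limsup_bounded)
  show "eventually (\<lambda>n. ereal (1 / (real n)\<^sup>2) * log_ennreal (V n)
      + ereal (real N / 2 * ln (real n)) \<le> ereal c) sequentially"
    using assms eventually_gt_at_top[of 0]
    by eventually_elim (subst growth_term_le_iff, auto)
qed

text \<open>Strictness matters: a limsup equal to c gives no eventual bound with c itself. This is
  why rates are compared through real c strictly above them.\<close>

lemma growth_rate_lessD:
  assumes "growth_rate N V < ereal c"
  shows "eventually (\<lambda>n. V n \<le> ennreal (exp ((real n)\<^sup>2 * (c - real N / 2 * ln (real n)))))
    sequentially"
  using Limsup_lessD[OF assms[unfolded growth_rate_def]] eventually_gt_at_top[of 0]
proof eventually_elim
  case (elim n)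
  then show ?case by (subst growth_term_le_iff[symmetric]) auto
qed

text \<open>Applied with d close to the value of the functional at a test polynomial, and with a
  very negative d to make the volume of the ball negligible.\<close>

lemma growth_rate_le_exp:
  assumes "eventually (\<lambda>n. V n \<le> ennreal (exp ((real n)\<^sup>2 * d)) * W n) sequentially"
  shows "growth_rate N V \<le> ereal d + growth_rate N W"
proof (rule ereal_le_if_real)
  fix c assume c: "ereal d + growth_rate N W < ereal c"
  have W: "growth_rate N W < ereal (c - d)"
    using c by (cases "growth_rate N W") auto
  have "eventually (\<lambda>n. V n \<le> ennreal (exp ((real n)\<^sup>2 * (c - real N / 2 * ln (real n)))))
    sequentially"
    using growth_rate_lessD[OF W] assms
  proof eventually_elim
    case (elim n)
    have "V n \<le> ennreal (exp ((real n)\<^sup>2 * d)) * W n" by fact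
    also have "\<dots> \<le> ennreal (exp ((real n)\<^sup>2 * d)) *
        ennreal (exp ((real n)\<^sup>2 * (c - d - real N / 2 * ln (real n))))"
      using elim(1) by (rule mult_left_mono) simp
    also have "\<dots> = ennreal (exp ((real n)\<^sup>2 * (c - real N / 2 * ln (real n))))"
      by (simp add: ennreal_mult[symmetric] exp_add[symmetric] algebra_simps)
    finally show ?case .
  qed
  then show "growth_rate N V \<le> ereal c" by (rule growth_rate_leI)
qed

lemma growth_rate_mono:
  assumes "eventually (\<lambda>n. V n \<le> W n) sequentially"
  shows "growth_rate N V \<le> growth_rate N W"
  using growth_rate_le_exp[of V 0 W N] assms by (simp add: zero_ereal_def[symmetric])

text \<open>A sum is at most twice its larger term, and the factor 2 is invisible on the scale
  e^(n^2).\<close>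

lemma growth_rate_add:
  "growth_rate N (\<lambda>n. V n + W n) \<le> max (growth_rate N V) (growth_rate N W)"
proof (rule ereal_le_if_real)
  fix c assume "max (growth_rate N V) (growth_rate N W) < ereal c"
  \<comment> \<open>The gap between c' and c is what absorbs the factor 2, as soon as n^2 (c - c')
    \<ge> log 2.\<close>
  then obtain c' where "max (growth_rate N V) (growth_rate N W) < ereal c'" and c': "c' < c"
    using ereal_dense2[of "max (growth_rate N V) (growth_rate N W)" "ereal c"] by auto
  then have V: "growth_rate N V < ereal c'" and W: "growth_rate N W < ereal c'" by auto
  have "filterlim (\<lambda>n. (real n)\<^sup>2 * (c - c')) at_top sequentially"
    using c' by real_asymp
  then have "eventually (\<lambda>n. ln 2 \<le> (real n)\<^sup>2 * (c - c')) sequentially"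
    by (simp add: filterlim_at_top)
  with growth_rate_lessD[OF V] growth_rate_lessD[OF W]
  have "eventually (\<lambda>n. V n + W n \<le>
    ennreal (exp ((real n)\<^sup>2 * (c - real N / 2 * ln (real n))))) sequentially"
  proof eventually_elim
    case (elim n)
    let ?b = "real N / 2 * ln (real n)"
    let ?e = "exp ((real n)\<^sup>2 * (c' - ?b))"
    have "V n + W n \<le> ennreal ?e + ennreal ?e"
      using elim(1,2) by (rule add_mono)
    also have "\<dots> = ennreal (2 * ?e)"
      by (simp add: ennreal_plus[symmetric] del: ennreal_plus)
    also have "2 * ?e = exp (ln 2 + (real n)\<^sup>2 * (c' - ?b))"
      by (simp add: exp_add)
    also have "\<dots> \<le> exp ((real n)\<^sup>2 * (c - ?b))"
      using elim(3) by (simp add: algebra_simps)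
    finally show ?case by (simp add: ennreal_leI)
  qed
  then show "growth_rate N (\<lambda>n. V n + W n) \<le> ereal c" by (rule growth_rate_leI)
qed

section \<open>Linear functionals on polynomials\<close>

text \<open>Puts the matricial traces and the functional of \<open>a\<close> into one form: both are
  linear extensions of a function on words or pairs of words, so they differ only in the moments
  inserted for \<open>g\<close>.\<close>

definition lin_ext :: "('k \<Rightarrow> complex) \<Rightarrow> ('k \<Rightarrow>\<^sub>0 complex) \<Rightarrow> complex"
  where "lin_ext g q = (\<Sum>k\<in>Poly_Mapping.keys q. Poly_Mapping.lookup q k * g k)"

lemma lin_ext_superset:
  assumes "finite S" "Poly_Mapping.keys q \<subseteq> S"
  shows "lin_ext g q = (\<Sum>k\<in>S. Poly_Mapping.lookup q k * g k)"
  unfolding lin_ext_def using assms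
  by (intro sum.mono_neutral_left) (auto simp: in_keys_iff)

lemma lin_ext_single [simp]: "lin_ext g (Poly_Mapping.single k c) = c * g k"
  by (simp add: lin_ext_def)

lemma lin_ext_zero [simp]: "lin_ext g 0 = 0"
  by (simp add: lin_ext_def)

lemma lin_ext_add [simp]: "lin_ext g (p + q) = lin_ext g p + lin_ext g q"
proof -
  let ?S = "Poly_Mapping.keys p \<union> Poly_Mapping.keys q"
  have "Poly_Mapping.keys (p + q) \<subseteq> ?S" by (rule Poly_Mapping.keys_add)
  then show ?thesis
    by (simp add: lin_ext_superset[of ?S] lookup_add distrib_right sum.distrib)
qed

lemma lin_ext_sum [simp]: "lin_ext g (sum f S) = (\<Sum>x\<in>S. lin_ext g (f x))"
  by (induction S rule: infinite_finite_induct) simp_all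

definition tensor_word :: "('n list \<Rightarrow> complex) \<Rightarrow> 'n list \<times> 'n list \<Rightarrow> complex"
  where "tensor_word \<phi> uv = \<phi> (fst uv) * \<phi> (snd uv)"

lemma ntrace2_eval_lin_ext:
  "ntrace2_eval n q A = lin_ext (tensor_word (\<lambda>w. ntrace n (word_mat n A w))) q"
  by (simp add: ntrace2_eval_def lin_ext_def tensor_word_def case_prod_unfold)

lemma scale_op_1: "scale_op 1 A = A"
proof (rule blinfun_eqI)
  fix x
  show "blinfun_apply (scale_op 1 A) x = blinfun_apply A x"
    using scaleC_of_real[of 1 "blinfun_apply A x"] by (simp add: scale_op.rep_eq)
qed

lemma tensor_functional_lin_ext:
  "tensor_functional (distribution \<tau> a) (distribution \<tau> a) q =
    lin_ext (tensor_word (\<lambda>w. \<tau> (word_op a w))) q"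
  by (simp add: tensor_functional_def lin_ext_def tensor_word_def case_prod_unfold
      distribution_def eval_op_def scale_op_1)

section \<open>Adjoints in the tensor square and the test polynomials\<close>

lemma star2_add: "star2 (p + q) = star2 p + star2 q"
proof (rule poly_mapping_eqI)
  fix uv :: "'a list \<times> 'a list"
  show "Poly_Mapping.lookup (star2 (p + q)) uv = Poly_Mapping.lookup (star2 p + star2 q) uv"
    by (cases uv) (simp add: lookup_star2 lookup_add)
qed

lemma star2_zero: "star2 0 = 0"
proof (rule poly_mapping_eqI)
  fix uv :: "'a list \<times> 'a list"
  show "Poly_Mapping.lookup (star2 0) uv = Poly_Mapping.lookup 0 uv"
    by (cases uv) (simp add: lookup_star2)
qed

lemma star2_sum: "star2 (sum f S) = (\<Sum>x\<in>S. star2 (f x))"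
  by (induction S rule: infinite_finite_induct) (simp_all add: star2_add star2_zero)

lemma star2_star2: "star2 (star2 q) = q"
proof (rule poly_mapping_eqI)
  fix uv :: "'a list \<times> 'a list"
  show "Poly_Mapping.lookup (star2 (star2 q)) uv = Poly_Mapping.lookup q uv"
    by (cases uv) (simp add: lookup_star2)
qed

lemma star2_single:
  "star2 (Poly_Mapping.single (u, v) c) = Poly_Mapping.single (rev u, rev v) (cnj c)"
proof (rule poly_mapping_eqI)
  fix uv :: "'a list \<times> 'a list"
  show "Poly_Mapping.lookup (star2 (Poly_Mapping.single (u, v) c)) uv =
      Poly_Mapping.lookup (Poly_Mapping.single (rev u, rev v) (cnj c)) uv"
    by (cases uv) (auto simp: lookup_star2 lookup_single when_def)
qed

text \<open>$K (X_w^* - \bar t) \otimes (X_w - t)$, made selfadjoint by adding its adjoint.\<close>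

definition deviation_poly :: "real \<Rightarrow> complex \<Rightarrow> 'n list \<Rightarrow> 'n ncpoly2"
  where "deviation_poly K t w =
    (let p = Poly_Mapping.single (rev w, w) (of_real K)
       + Poly_Mapping.single (rev w, []) (- of_real K * t)
       + Poly_Mapping.single ([], w) (- of_real K * cnj t)
       + Poly_Mapping.single ([], []) (of_real K * (t * cnj t))
     in p + star2 p)"

lemma deviation_poly_sa: "deviation_poly K t w \<in> ncpoly2_sa"
  by (simp add: ncpoly2_sa_def deviation_poly_def Let_def star2_add star2_star2 add.commute)

text \<open>The adjoint has the two legs exchanged, and \<open>tensor_word \<phi>\<close> is
  symmetric in them; hence the factor 2. The value vanishes at \<phi> w = t, and it is 2 K |\<phi> w
  - t|^2 whenever \<phi> sends the reversed word to the conjugate.\<close>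

lemma lin_ext_deviation_poly:
  assumes "\<phi> [] = 1"
  shows "lin_ext (tensor_word \<phi>) (deviation_poly K t w) =
    2 * of_real K * (\<phi> (rev w) - cnj t) * (\<phi> w - t)"
  using assms
  by (simp add: deviation_poly_def Let_def star2_add star2_single tensor_word_def algebra_simps)

lemma ncpoly2_sa_sum: "(\<And>x. x \<in> S \<Longrightarrow> f x \<in> ncpoly2_sa) \<Longrightarrow> sum f S \<in> ncpoly2_sa"
  by (simp add: ncpoly2_sa_def star2_sum)

definition tensor_one :: "'n ncpoly \<Rightarrow> 'n ncpoly2"
  where "tensor_one p =
    (\<Sum>w\<in>Poly_Mapping.keys p. Poly_Mapping.single (w, []) (Poly_Mapping.lookup p w))"

lemma lookup_tensor_one:
  "Poly_Mapping.lookup (tensor_one p) (u, v) = (if v = [] then Poly_Mapping.lookup p u else 0)"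
proof -
  have "Poly_Mapping.lookup (tensor_one p) (u, v) =
      (\<Sum>w\<in>Poly_Mapping.keys p. if w = u then (if v = [] then Poly_Mapping.lookup p u else 0) else 0)"
    unfolding tensor_one_def lookup_sum
    by (intro sum.cong refl) (auto simp: lookup_single when_def)
  then show ?thesis by (auto simp: in_keys_iff)
qed

lemma tensor_one_sa:
  assumes "p \<in> ncpoly_sa"
  shows "tensor_one p \<in> ncpoly2_sa"
proof -
  have "cnj (Poly_Mapping.lookup p (rev u)) = Poly_Mapping.lookup p u" for u
    using assms lookup_star[of p u] by (simp add: ncpoly_sa_def)
  moreover have "Poly_Mapping.lookup (star2 (tensor_one p)) uv =
      Poly_Mapping.lookup (tensor_one p) uv"
    if "\<And>u. cnj (Poly_Mapping.lookup p (rev u)) = Poly_Mapping.lookup p u" for uv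
    using that by (cases uv) (simp add: lookup_star2 lookup_tensor_one)
  ultimately show ?thesis
    by (auto simp: ncpoly2_sa_def intro!: poly_mapping_eqI)
qed

lemma lin_ext_tensor_one:
  assumes "\<phi> [] = 1"
  shows "lin_ext (tensor_word \<phi>) (tensor_one p) = lin_ext \<phi> p"
  using assms by (simp add: tensor_one_def tensor_word_def) (simp add: lin_ext_def)

text \<open>Only finitely many words occur in \<open>q\<close>, and xy - st = x(y - t) + t(x - s)
  controls each product. The bounds \<open>r\<close> and \<epsilon> do not depend on
  \<open>x\<close>, so one choice serves all matrix sizes n.\<close>

lemma lin_ext_tensor_word_continuous:
  fixes t :: "'n list \<Rightarrow> complex"
  assumes "0 < \<delta>"
  shows "\<exists>r. \<exists>\<epsilon>>0. \<forall>x. (\<forall>w. length w \<le> r \<longrightarrow> cmod (x w - t w) \<le> \<epsilon>) \<longrightarrow>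
    cmod (lin_ext (tensor_word x) q - lin_ext (tensor_word t) q) \<le> \<delta>"
proof -
  \<comment> \<open>The total of all lengths is a crude bound that covers both legs of every
    monomial.\<close>
  define r where "r = (\<Sum>k\<in>Poly_Mapping.keys q. length (fst k) + length (snd k))"
  define b where "b k = cmod (Poly_Mapping.lookup q k) *
    (1 + cmod (t (fst k)) + cmod (t (snd k)))" for k
  define C where "C = (\<Sum>k\<in>Poly_Mapping.keys q. b k)"
  \<comment> \<open>The cap 1 gives |x u| \<le> |t u| + 1, which the weights \<open>b\<close>
    already contain; C + 1 avoids division by zero.\<close>
  define \<epsilon> where "\<epsilon> = min 1 (\<delta> / (C + 1))"
  have C: "0 \<le> C" by (simp add: C_def b_def sum_nonneg)
  have \<epsilon>: "0 < \<epsilon>" "\<epsilon> \<le> 1" using assms C by (auto simp: \<epsilon>_def)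
  have "\<epsilon> * C \<le> \<delta> / (C + 1) * (C + 1)"
    using C assms by (intro mult_mono) (auto simp: \<epsilon>_def)
  with C have \<epsilon>C: "\<epsilon> * C \<le> \<delta>" by simp
  show ?thesis
  proof (intro exI[of _ r] exI[of _ \<epsilon>] conjI allI impI \<epsilon>(1))
    fix x assume x: "\<forall>w. length w \<le> r \<longrightarrow> cmod (x w - t w) \<le> \<epsilon>"
    have "cmod (tensor_word x k - tensor_word t k) \<le>
        \<epsilon> * (1 + cmod (t (fst k)) + cmod (t (snd k)))" if "k \<in> Poly_Mapping.keys q" for k
    proof -
      obtain u v where k: "k = (u, v)" by (cases k)
      have "length u + length v \<le> r"
        unfolding r_def using member_le_sum[OF that, of "\<lambda>k. length (fst k) + length (snd k)"]
        by (simp add: k)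
      then have u: "cmod (x u - t u) \<le> \<epsilon>" and v: "cmod (x v - t v) \<le> \<epsilon>"
        using x by simp_all
      have "cmod (x u) \<le> cmod (t u) + cmod (x u - t u)"
        using norm_triangle_ineq[of "t u" "x u - t u"] by simp
      with u \<epsilon> have xu: "cmod (x u) \<le> cmod (t u) + 1" by simp
      have "x u * x v - t u * t v = x u * (x v - t v) + t v * (x u - t u)"
        by (simp add: algebra_simps)
      then have "cmod (x u * x v - t u * t v) \<le>
          cmod (x u) * cmod (x v - t v) + cmod (t v) * cmod (x u - t u)"
        by (metis norm_mult norm_triangle_ineq)
      also have "\<dots> \<le> (cmod (t u) + 1) * \<epsilon> + cmod (t v) * \<epsilon>"
        using u v xu by (intro add_mono mult_mono) auto
      finally show ?thesis by (simp add: tensor_word_def k algebra_simps)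
    qed
    then have "cmod (Poly_Mapping.lookup q k * (tensor_word x k - tensor_word t k)) \<le> \<epsilon> * b k"
      if "k \<in> Poly_Mapping.keys q" for k
      using mult_left_mono[OF _ norm_ge_zero[of "Poly_Mapping.lookup q k"]] that
      unfolding norm_mult b_def mult.left_commute[of \<epsilon>] by blast
    then have "cmod (\<Sum>k\<in>Poly_Mapping.keys q.
        Poly_Mapping.lookup q k * (tensor_word x k - tensor_word t k)) \<le> \<epsilon> * C"
      unfolding C_def sum_distrib_left by (rule sum_norm_le)
    then show "cmod (lin_ext (tensor_word x) q - lin_ext (tensor_word t) q) \<le> \<delta>"
      using \<epsilon>C by (simp add: lin_ext_def right_diff_distrib sum_subtractf)
  qed
qed

section \<open>Traces of words in hermitian matrices\<close>

lemma ntrace_eval_mat: "ntrace n (eval_mat n p A) = lin_ext (\<lambda>w. ntrace n (word_mat n A w)) p"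
proof -
  have "(\<Sum>i<n. eval_mat n p A $$ (i, i)) = (\<Sum>i<n. \<Sum>w\<in>Poly_Mapping.keys p.
      Poly_Mapping.lookup p w * word_mat n A w $$ (i, i))"
    by (simp add: eval_mat_def)
  also have "\<dots> = (\<Sum>w\<in>Poly_Mapping.keys p. \<Sum>i<n.
      Poly_Mapping.lookup p w * word_mat n A w $$ (i, i))"
    by (rule sum.swap)
  finally show ?thesis
    by (simp add: ntrace_def lin_ext_def sum_divide_distrib sum_distrib_left)
qed

lemma ntrace_word_Nil: "0 < n \<Longrightarrow> ntrace n (word_mat n A []) = 1"
  by (simp add: ntrace_def word_mat_def)

lemma word_mat_carrier: "(\<And>i. A i \<in> carrier_mat n n) \<Longrightarrow> word_mat n A w \<in> carrier_mat n n"
  by (induction w) (auto simp: word_mat_def intro!: mult_carrier_mat[of _ n n])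

lemma word_mat_Cons: "word_mat n A (i # w) = A i * word_mat n A w"
  by (simp add: word_mat_def)

lemma word_mat_append:
  assumes "\<And>i. A i \<in> carrier_mat n n"
  shows "word_mat n A (u @ v) = word_mat n A u * word_mat n A v"
proof (induction u)
  case Nil
  show ?case using word_mat_carrier[of A n v] assms by (simp add: word_mat_def)
next
  case (Cons i u)
  then show ?case
    using assoc_mult_mat[OF assms[of i] word_mat_carrier[OF assms, where w = u]
        word_mat_carrier[OF assms, where w = v]]
    by (simp add: word_mat_Cons)
qed

lemma index_mult_mat_sum:
  assumes "A \<in> carrier_mat n n" "B \<in> carrier_mat n n" "i < n" "j < n"
  shows "(A * B) $$ (i, j) = (\<Sum>k<n. A $$ (i, k) * B $$ (k, j))"
  using assms by (auto simp: scalar_prod_def atLeast0LessThan)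

text \<open>The adjoint of a product of hermitian matrices is the product in reverse order. It makes
  the deviation polynomials evaluate to squared moduli.\<close>

lemma word_mat_rev:
  assumes A: "\<And>i. A i \<in> herm_mats n" and ij: "i < n" "j < n"
  shows "word_mat n A (rev w) $$ (i, j) = cnj (word_mat n A w $$ (j, i))"
  using ij
proof (induction w arbitrary: i j)
  case Nil
  then show ?case by (simp add: word_mat_def)
next
  case (Cons x w)
  have carrier: "A i \<in> carrier_mat n n" for i
    using A unfolding herm_mats_iff by blast
  have h: "A x $$ (k, j) = cnj (A x $$ (j, k))" if "k < n" for k
    using A[of x] that Cons.prems unfolding herm_mats_iff by blast
  have "word_mat n A (rev (x # w)) $$ (i, j) = (word_mat n A (rev w) * A x) $$ (i, j)"
    using right_mult_one_mat[OF carrier]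
    by (simp add: word_mat_append[OF carrier] word_mat_Cons) (simp add: word_mat_def)
  also have "\<dots> = (\<Sum>k<n. word_mat n A (rev w) $$ (i, k) * A x $$ (k, j))"
    using Cons.prems by (intro index_mult_mat_sum word_mat_carrier carrier)
  also have "\<dots> = (\<Sum>k<n. cnj (word_mat n A w $$ (k, i)) * cnj (A x $$ (j, k)))"
    using Cons.prems by (intro sum.cong refl arg_cong2[where f = "(*)"] Cons.IH h) auto
  also have "\<dots> = cnj ((A x * word_mat n A w) $$ (j, i))"
    using Cons.prems
    by (simp add: index_mult_mat_sum[OF carrier word_mat_carrier[OF carrier]] mult.commute)
  finally show ?case by (simp add: word_mat_Cons)
qed

lemma ntrace_word_rev:
  "(\<And>i. A i \<in> herm_mats n) \<Longrightarrow> ntrace n (word_mat n A (rev w)) = cnj (ntrace n (word_mat n A w))"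
  by (simp add: ntrace_def word_mat_rev)

unbundle no vec_syntax

section \<open>Measurability and volume of the matrix balls\<close>

lemma euclid_norm_sum: "euclid_norm v = sqrt (\<Sum>i<dim_vec v. (cmod (v $ i))\<^sup>2)"
proof -
  have "Re (v \<bullet>c v) = (\<Sum>i<dim_vec v. (cmod (v $ i))\<^sup>2)"
    by (simp add: scalar_prod_def atLeast0LessThan cmod_power2 flip: power2_eq_square)
  then show ?thesis by (simp add: euclid_norm_def)
qed

lemma cmod_le_euclid_norm:
  assumes "i < dim_vec v"
  shows "cmod (v $ i) \<le> euclid_norm v"
proof -
  have "(cmod (v $ i))\<^sup>2 \<le> (\<Sum>i<dim_vec v. (cmod (v $ i))\<^sup>2)"
    using assms by (intro member_le_sum) auto
  then show ?thesis unfolding euclid_norm_sum by (rule real_le_rsqrt)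
qed

lemma index_mult_mat_vec_sum:
  "A \<in> carrier_mat n n \<Longrightarrow> v \<in> carrier_vec n \<Longrightarrow> i < n \<Longrightarrow> (A *\<^sub>v v) $ i = (\<Sum>j<n. A $$ (i, j) * v $ j)"
  by (auto simp: scalar_prod_def atLeast0LessThan)

text \<open>A real \<open>SUP\<close> is meaningful only over a nonempty set that is bounded above;
  the absolute row sums of A give the bound and the zero vector gives nonemptiness.\<close>

lemma mat_opnorm_le_iff:
  assumes A: "A \<in> carrier_mat n n"
  shows "mat_opnorm A \<le> R \<longleftrightarrow>
    (\<forall>v\<in>carrier_vec n. euclid_norm v \<le> 1 \<longrightarrow> euclid_norm (A *\<^sub>v v) \<le> R)"
proof -
  let ?U = "{v \<in> carrier_vec n. euclid_norm v \<le> 1}"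
  have "bdd_above ((\<lambda>v. euclid_norm (A *\<^sub>v v)) ` ?U)"
  proof (rule bdd_aboveI2)
    fix v assume v: "v \<in> ?U"
    have "cmod ((A *\<^sub>v v) $ i) \<le> (\<Sum>j<n. cmod (A $$ (i, j)))" if "i < n" for i
    proof -
      have "cmod ((A *\<^sub>v v) $ i) \<le> (\<Sum>j<n. cmod (A $$ (i, j) * v $ j))"
        using v that A by (simp add: index_mult_mat_vec_sum[of A n] norm_sum del: index_mult_mat_vec)
      also have "\<dots> \<le> (\<Sum>j<n. cmod (A $$ (i, j)))"
      proof (rule sum_mono)
        fix j assume "j \<in> {..<n}"
        then have "cmod (v $ j) \<le> 1"
          using v cmod_le_euclid_norm[of j v] by auto
        then show "cmod (A $$ (i, j) * v $ j) \<le> cmod (A $$ (i, j))"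
          by (simp add: norm_mult mult_left_le)
      qed
      finally show ?thesis .
    qed
    then have "(\<Sum>i<n. (cmod ((A *\<^sub>v v) $ i))\<^sup>2) \<le> (\<Sum>i<n. (\<Sum>j<n. cmod (A $$ (i, j)))\<^sup>2)"
      by (intro sum_mono power_mono) auto
    then show "euclid_norm (A *\<^sub>v v) \<le> sqrt (\<Sum>i<n. (\<Sum>j<n. cmod (A $$ (i, j)))\<^sup>2)"
      using A by (simp add: euclid_norm_sum)
  qed
  moreover have "0\<^sub>v n \<in> ?U"
    by (simp add: euclid_norm_sum)
  then have "?U \<noteq> {}" by blast
  ultimately show ?thesis
    using A unfolding mat_opnorm_def by (subst cSUP_le_iff) auto
qed

text \<open>Column j is the image of the unit vector e_j, so its norm is at most R, and there are n
  columns.\<close>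

lemma sum_cmod_square_le:
  assumes A: "A \<in> carrier_mat n n" and R: "mat_opnorm A \<le> R"
  shows "(\<Sum>i<n. \<Sum>j<n. (cmod (A $$ (i, j)))\<^sup>2) \<le> real n * R\<^sup>2"
proof -
  have "(\<Sum>i<n. (cmod (A $$ (i, j)))\<^sup>2) \<le> R\<^sup>2" if j: "j < n" for j
  proof -
    have "(\<Sum>i<n. (cmod (unit_vec n j $ i))\<^sup>2) = (\<Sum>i<n. if i = j then 1 else 0)"
      using j by (intro sum.cong) auto
    then have "euclid_norm (unit_vec n j :: complex vec) = 1"
      using j by (simp add: euclid_norm_sum)
    then have le: "euclid_norm (A *\<^sub>v unit_vec n j) \<le> R"
      using R unfolding mat_opnorm_le_iff[OF A] by simp
    have "(A *\<^sub>v unit_vec n j) $ i = A $$ (i, j)" if "i < n" for i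
      using that j A by simp
    then have "euclid_norm (A *\<^sub>v unit_vec n j) = sqrt (\<Sum>i<n. (cmod (A $$ (i, j)))\<^sup>2)"
      using A by (simp add: euclid_norm_sum del: index_mult_mat_vec)
    with le show ?thesis by (metis sqrt_le_D)
  qed
  then have "(\<Sum>j<n. \<Sum>i<n. (cmod (A $$ (i, j)))\<^sup>2) \<le> (\<Sum>j<n. R\<^sup>2)"
    by (intro sum_mono) auto
  then show ?thesis
    by (subst sum.swap) simp
qed

section \<open>Transport from real coordinates to hermitian matrices\<close>

abbreviation coord_measure :: "nat \<Rightarrow> (nat \<times> nat \<Rightarrow> real) measure"
  where "coord_measure n \<equiv> Pi\<^sub>M ({..<n} \<times> {..<n}) (\<lambda>_. lborel)"

lemma herm_of_coords_carrier: "herm_of_coords n x \<in> carrier_mat n n"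
  by (simp add: herm_of_coords_def)

lemma herm_of_coords_cong:
  "(\<And>k. k \<in> {..<n} \<times> {..<n} \<Longrightarrow> x k = y k) \<Longrightarrow> herm_of_coords n x = herm_of_coords n y"
  by (rule eq_matI) (auto simp: herm_of_coords_def)

text \<open>A countable cover of the coordinate space by sets of finite measure is carried over by
  the injective parametrization. This makes the product formula for \<open>Lambda_power\<close>
  available.\<close>

lemma sigma_finite_Lambda: "sigma_finite_measure (Lambda n)"
proof -
  interpret product_sigma_finite "\<lambda>_ :: nat \<times> nat. lborel :: real measure" ..
  interpret P: sigma_finite_measure "coord_measure n"
    by (rule sigma_finite) simp
  note inj = inj_on_herm_of_coords[of n]
  obtain A where A: "countable A" "A \<subseteq> sets (coord_measure n)"
      "\<Union>A = space (coord_measure n)" "\<And>a. a \<in> A \<Longrightarrow> emeasure (coord_measure n) a \<noteq> \<infinity>"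
    using P.sigma_finite_countable by blast
  show ?thesis
  proof (rule sigma_finite_measure.intro, intro exI[of _ "(`) (herm_of_coords n) ` A"] conjI ballI)
    show "countable ((`) (herm_of_coords n) ` A)" using A(1) by simp
    show "(`) (herm_of_coords n) ` A \<subseteq> sets (Lambda n)"
      using A(2) by (auto simp: Lambda_def intro: in_sets_embed_measure)
    show "\<Union>((`) (herm_of_coords n) ` A) = space (Lambda n)"
      by (simp add: Lambda_def space_scale_measure space_embed_measure A(3)[symmetric] image_Union)
    fix B assume "B \<in> (`) (herm_of_coords n) ` A"
    then obtain a where a: "a \<in> A" "B = herm_of_coords n ` a" by blast
    then have "emeasure (Lambda n) B = 2 ^ (n * (n - 1) div 2) * emeasure (coord_measure n) a"
      using A(2) by (auto simp: Lambda_def emeasure_embed_measure_image'[OF inj])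
    then show "emeasure (Lambda n) B \<noteq> \<infinity>"
      using A(4)[OF a(1)] by (simp add: ennreal_mult_eq_top_iff power_eq_top_ennreal)
  qed
qed

interpretation Lambda: product_sigma_finite "\<lambda>_. Lambda n" for n
  by (rule product_sigma_finite.intro) (rule sigma_finite_Lambda)

definition herm_ball :: "nat \<Rightarrow> real \<Rightarrow> complex mat set"
  where "herm_ball n R = {A \<in> herm_mats n. mat_opnorm A \<le> R}"

lemma continuous_on_herm_of_coords:
  assumes "i < n" "j < n"
  shows "continuous_on UNIV (\<lambda>x. herm_of_coords n x $$ (i, j))"
proof -
  have c: "continuous_on UNIV (\<lambda>x :: nat \<times> nat \<Rightarrow> real. x k)" for k
    by (rule continuous_on_product_coordinates)
  show ?thesis
    using assms
    by (cases i j rule: linorder_cases)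
      (auto simp: herm_of_coords_def Complex_eq intro!: continuous_intros c)
qed

text \<open>The norm bound is a condition for every vector of the unit ball, in general uncountably
  many; closed conditions survive such an intersection, measurable ones need not.\<close>

lemma closed_coord_ball: "closed {x. mat_opnorm (herm_of_coords n x) \<le> R}"
proof -
  have *: "continuous_on UNIV (\<lambda>x. euclid_norm (herm_of_coords n x *\<^sub>v v))"
    if v: "v \<in> carrier_vec n" for v
  proof -
    have "euclid_norm (herm_of_coords n x *\<^sub>v v) =
        sqrt (\<Sum>i<n. (cmod (\<Sum>j<n. herm_of_coords n x $$ (i, j) * v $ j))\<^sup>2)" for x
      using herm_of_coords_carrier[of n x] v
      by (auto simp: euclid_norm_sum index_mult_mat_vec_sum[of _ n] simp del: index_mult_mat_vec)
    then show ?thesis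
      by (auto intro!: continuous_intros continuous_on_herm_of_coords)
  qed
  have "closed (\<Inter>v\<in>{v \<in> carrier_vec n. euclid_norm v \<le> 1}.
      {x. euclid_norm (herm_of_coords n x *\<^sub>v v) \<le> R})"
    by (intro closed_INT ballI closed_Collect_le * continuous_on_const) simp
  also have "\<dots> = {x. mat_opnorm (herm_of_coords n x) \<le> R}"
    by (auto simp: mat_opnorm_le_iff[OF herm_of_coords_carrier])
  finally show ?thesis .
qed

definition coord_ball :: "nat \<Rightarrow> real \<Rightarrow> (nat \<times> nat \<Rightarrow> real) set"
  where "coord_ball n R = {x \<in> space (coord_measure n). mat_opnorm (herm_of_coords n x) \<le> R}"

lemma sets_coord_ball: "coord_ball n R \<in> sets (coord_measure n)"
proof -
  let ?I = "{..<n} \<times> {..<n}"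
  \<comment> \<open>Points of \<open>coord_measure n\<close> are undefined outside the index square,
    while the closed ball lives in the space of all functions. Extension by zero is measurable
    between them and does not change the matrix; on the countable index type the product
    sigma-algebra is the Borel one.\<close>
  let ?g = "\<lambda>(x :: nat \<times> nat \<Rightarrow> real) k. if k \<in> ?I then x k else 0"
  let ?S = "{x. mat_opnorm (herm_of_coords n x) \<le> R}"
  have "?g \<in> measurable (coord_measure n) (Pi\<^sub>M UNIV (\<lambda>_. borel))"
  proof (rule measurable_PiM_single')
    fix k :: "nat \<times> nat"
    show "(\<lambda>x. ?g x k) \<in> borel_measurable (coord_measure n)"
    proof (cases "k \<in> ?I")
      case True
      then have "(\<lambda>x. x k) \<in> measurable (coord_measure n) lborel"
        by (rule measurable_component_singleton)
      with True show ?thesis by simp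
    qed auto
  qed auto
  moreover have "?S \<in> sets (Pi\<^sub>M UNIV (\<lambda>_. borel))"
    unfolding sets_PiM_equal_borel using closed_coord_ball by (rule borel_closed)
  ultimately have "?g -` ?S \<inter> space (coord_measure n) \<in> sets (coord_measure n)"
    by (rule measurable_sets)
  also have "?g -` ?S \<inter> space (coord_measure n) = coord_ball n R"
    using herm_of_coords_cong[of n "?g x" x for x] by (auto simp: coord_ball_def)
  finally show ?thesis .
qed

lemma herm_ball_image: "herm_ball n R = herm_of_coords n ` coord_ball n R"
proof -
  have "herm_mats n = herm_of_coords n ` space (coord_measure n)"
    by (simp add: space_Lambda[symmetric] Lambda_def space_scale_measure space_embed_measure)
  then show ?thesis by (auto simp: herm_ball_def coord_ball_def)
qed

lemma sets_herm_ball: "herm_ball n R \<in> sets (Lambda n)"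
  unfolding herm_ball_image
  by (simp add: Lambda_def in_sets_embed_measure sets_coord_ball)

section \<open>Gaussian bound for the volume of the ball\<close>

lemma nn_integral_gaussian:
  assumes "0 < (s :: real)"
  shows "(\<integral>\<^sup>+x. ennreal (exp (- (s / 2) * x\<^sup>2)) \<partial>lborel) = ennreal (sqrt (2 * pi / s))"
proof -
  let ?\<sigma> = "1 / sqrt s"
  have eq: "exp (- (s / 2) * x\<^sup>2) = sqrt (2 * pi / s) * normal_density 0 ?\<sigma> x" for x
    using assms by (simp add: normal_density_def power_divide real_sqrt_divide real_sqrt_mult)
  have "(\<integral>\<^sup>+x. ennreal (normal_density 0 ?\<sigma> x) \<partial>lborel) = 1"
    using assms by (subst nn_integral_eq_integral) (auto simp: normal_density_nonneg)
  then show ?thesis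
    unfolding eq using assms
    by (simp add: ennreal_mult normal_density_nonneg nn_integral_cmult)
qed

text \<open>On the ball the squared coordinates sum to at most \<open>n * R\<^sup>2\<close>, so its indicator is
  dominated by \<open>exp (n\<^sup>2 * R\<^sup>2 / 2)\<close> times a Gaussian of variance \<open>1 / n\<close>.\<close>

lemma emeasure_coord_ball_le:
  assumes n: "0 < n"
  shows "emeasure (coord_measure n) (coord_ball n R) \<le>
    ennreal (exp ((real n)\<^sup>2 * (R\<^sup>2 / 2 + ln (2 * pi) / 2 - ln (real n) / 2)))"
proof -
  let ?I = "{..<n} \<times> {..<n}"
  interpret product_sigma_finite "\<lambda>_ :: nat \<times> nat. lborel :: real measure" ..
  let ?f = "\<lambda>x :: real. ennreal (exp (- (real n / 2) * x\<^sup>2))"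
  let ?e = "ennreal (exp ((real n)\<^sup>2 * R\<^sup>2 / 2))"
  have meas: "(\<lambda>x. \<Prod>k\<in>?I. ?f (x k)) \<in> borel_measurable (coord_measure n)"
  proof (rule borel_measurable_prod_ennreal)
    fix k assume "k \<in> ?I"
    then have "(\<lambda>x. x k) \<in> measurable (coord_measure n) lborel"
      by (rule measurable_component_singleton)
    then have [measurable]: "(\<lambda>x. x k) \<in> borel_measurable (coord_measure n)" by simp
    show "(\<lambda>x. ?f (x k)) \<in> borel_measurable (coord_measure n)" by measurable
  qed
  have bound: "1 \<le> ?e * (\<Prod>k\<in>?I. ?f (x k))" if x: "x \<in> coord_ball n R" for x
  proof -
    let ?H = "herm_of_coords n x"
    \<comment> \<open>Coordinates above and below the diagonal are the real and, up to sign, the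
      imaginary part of the entry at the same position, so none exceeds the modulus of that
      entry.\<close>
    have "(x (i, j))\<^sup>2 \<le> (cmod (?H $$ (i, j)))\<^sup>2" if "i < n" "j < n" for i j
      using that by (cases i j rule: linorder_cases) (simp_all add: herm_of_coords_def cmod_power2)
    then have "(\<Sum>i<n. \<Sum>j<n. (x (i, j))\<^sup>2) \<le> (\<Sum>i<n. \<Sum>j<n. (cmod (?H $$ (i, j)))\<^sup>2)"
      by (intro sum_mono) auto
    also have "\<dots> \<le> real n * R\<^sup>2"
      using x by (intro sum_cmod_square_le herm_of_coords_carrier) (simp add: coord_ball_def)
    finally have "(\<Sum>k\<in>?I. (x k)\<^sup>2) \<le> real n * R\<^sup>2"
      by (simp add: sum.cartesian_product case_prod_unfold)
    then have "real n / 2 * (\<Sum>k\<in>?I. (x k)\<^sup>2) \<le> real n / 2 * (real n * R\<^sup>2)"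
      by (rule mult_left_mono) simp
    then have "0 \<le> (real n)\<^sup>2 * R\<^sup>2 / 2 + - (real n / 2) * (\<Sum>k\<in>?I. (x k)\<^sup>2)"
      by (simp add: power2_eq_square mult.assoc)
    then have "1 \<le> exp ((real n)\<^sup>2 * R\<^sup>2 / 2 + (\<Sum>k\<in>?I. - (real n / 2) * (x k)\<^sup>2))"
      unfolding sum_distrib_left[symmetric] by simp
    also have "\<dots> = exp ((real n)\<^sup>2 * R\<^sup>2 / 2) * (\<Prod>k\<in>?I. exp (- (real n / 2) * (x k)\<^sup>2))"
      by (simp add: exp_add exp_sum)
    finally show ?thesis
      by (simp add: prod_ennreal ennreal_mult[symmetric] prod_nonneg)
  qed
  have "emeasure (coord_measure n) (coord_ball n R) =
      (\<integral>\<^sup>+x. indicator (coord_ball n R) x \<partial>coord_measure n)"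
    using sets_coord_ball by simp
  also have "\<dots> \<le> (\<integral>\<^sup>+x. ?e * (\<Prod>k\<in>?I. ?f (x k)) \<partial>coord_measure n)"
    using bound by (intro nn_integral_mono) (auto split: split_indicator)
  also have "\<dots> = ?e * (\<integral>\<^sup>+x. (\<Prod>k\<in>?I. ?f (x k)) \<partial>coord_measure n)"
    using meas by (rule nn_integral_cmult)
  also have "(\<integral>\<^sup>+x. (\<Prod>k\<in>?I. ?f (x k)) \<partial>coord_measure n) = (\<Prod>k\<in>?I. \<integral>\<^sup>+x. ?f x \<partial>lborel)"
    by (rule product_nn_integral_prod) auto
  \<comment> \<open>One factor for each of the n^2 coordinates; with variance 1/n this contributes
    -log(n)/2 per unit of n^2.\<close>
  also have "\<dots> = ennreal (sqrt (2 * pi / real n)) ^ (n * n)"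
    using n by (simp only: nn_integral_gaussian of_nat_0_less_iff prod_constant card_cartesian_product
        card_lessThan)
  also have "sqrt (2 * pi / real n) = exp (ln (2 * pi) / 2 - ln (real n) / 2)"
    using n by (simp add: exp_diff real_sqrt_divide flip: ln_sqrt)
  also have "?e * ennreal (exp (ln (2 * pi) / 2 - ln (real n) / 2)) ^ (n * n) =
      ennreal (exp ((real n)\<^sup>2 * (R\<^sup>2 / 2 + ln (2 * pi) / 2 - ln (real n) / 2)))"
    by (simp add: ennreal_power ennreal_mult[symmetric] exp_of_nat_mult[symmetric]
        exp_add[symmetric] power2_eq_square algebra_simps)
  finally show ?thesis .
qed

lemma emeasure_herm_ball_le:
  assumes n: "0 < n"
  shows "emeasure (Lambda n) (herm_ball n R) \<le>
    ennreal (exp ((real n)\<^sup>2 * (R\<^sup>2 / 2 + ln (2 * pi) / 2 + ln 2 - ln (real n) / 2)))"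
proof -
  let ?c = "R\<^sup>2 / 2 + ln (2 * pi) / 2 - ln (real n) / 2"
  have "emeasure (Lambda n) (herm_ball n R) =
      2 ^ (n * (n - 1) div 2) * emeasure (coord_measure n) (coord_ball n R)"
    unfolding herm_ball_image Lambda_def
    by (simp add: emeasure_embed_measure_image'[OF inj_on_herm_of_coords sets_coord_ball])
  \<comment> \<open>The density factor of \<open>Lambda\<close> is bounded generously; it adds log 2
    to the rate constant.\<close>
  also have "\<dots> \<le> 2 ^ (n * n) * ennreal (exp ((real n)\<^sup>2 * ?c))"
  proof (intro mult_mono emeasure_coord_ball_le n power_increasing)
    show "n * (n - 1) div 2 \<le> n * n"
      by (meson div_le_dividend diff_le_self le_trans mult_le_mono2)
  qed auto
  also have "(2 :: ennreal) ^ (n * n) = ennreal (exp ((real n)\<^sup>2 * ln 2))"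
  proof -
    have "exp ((real n)\<^sup>2 * ln 2) = (2 :: real) ^ (n * n)"
      using exp_of_nat_mult[of "n * n" "ln 2 :: real"] by (simp add: power2_eq_square)
    then show ?thesis by (simp add: ennreal_power[symmetric])
  qed
  finally show ?thesis
    by (simp add: ennreal_mult[symmetric] exp_add[symmetric] algebra_simps)
qed

lemma mat_ball_PiE: "mat_ball n R = Pi\<^sub>E UNIV (\<lambda>_. herm_ball n R)"
  by (auto simp: mat_ball_def herm_ball_def PiE_def)

lemma sets_mat_ball: "mat_ball n R \<in> sets (Lambda_power n :: ('n :: finite \<Rightarrow> _) measure)"
  unfolding mat_ball_PiE Lambda_power_def
  by (rule sets_PiM_I_finite) (auto simp: sets_herm_ball)

text \<open>The volume is the N-th power of that of one ball, so the terms -log(n)/2 add up to the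
  -(N/2) log n that the normalization cancels.\<close>

lemma growth_rate_mat_ball:
  "growth_rate CARD('n) (\<lambda>n. emeasure (Lambda_power n) (mat_ball n R :: ('n :: finite \<Rightarrow> _) set)) \<le>
    ereal (real CARD('n) * (R\<^sup>2 / 2 + ln (2 * pi) / 2 + ln 2))"
proof (rule growth_rate_leI)
  let ?c = "R\<^sup>2 / 2 + ln (2 * pi) / 2 + ln 2"
  show "eventually (\<lambda>n. emeasure (Lambda_power n) (mat_ball n R :: ('n \<Rightarrow> _) set) \<le>
      ennreal (exp ((real n)\<^sup>2 * (real CARD('n) * ?c - real CARD('n) / 2 * ln (real n)))))
      sequentially"
    using eventually_gt_at_top[of 0]
  proof eventually_elim
    case (elim n)
    have "emeasure (Lambda_power n) (mat_ball n R :: ('n \<Rightarrow> _) set) =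
        emeasure (Lambda n) (herm_ball n R) ^ CARD('n)"
      unfolding mat_ball_PiE Lambda_power_def
      by (subst Lambda.emeasure_PiM) (auto simp: sets_herm_ball)
    also have "\<dots> \<le> ennreal (exp ((real n)\<^sup>2 * (?c - ln (real n) / 2))) ^ CARD('n)"
      using emeasure_herm_ball_le[OF elim] by (rule power_mono) simp
    also have "\<dots> = ennreal (exp ((real n)\<^sup>2 * (real CARD('n) * ?c - real CARD('n) / 2 * ln (real n))))"
      by (simp add: ennreal_power exp_of_nat_mult[symmetric] algebra_simps)
    finally show ?case .
  qed
qed

section \<open>Measurability of traces and of microstate sets\<close>

lemma measurable_Lambda_entry:
  assumes "i < n" "j < n"
  shows "(\<lambda>A. A $$ (i, j)) \<in> borel_measurable (Lambda n)"
proof -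
  have c: "(\<lambda>x. x k) \<in> borel_measurable (coord_measure n)" if "k \<in> {..<n} \<times> {..<n}" for k
    using measurable_component_singleton[OF that, of "\<lambda>_. lborel :: real measure"] by simp
  have "(\<lambda>x. herm_of_coords n x $$ (i, j)) \<in> borel_measurable (coord_measure n)"
    using assms by (cases i j rule: linorder_cases)
      (auto simp: herm_of_coords_def Complex_eq intro!: borel_measurable_add borel_measurable_diff
        borel_measurable_times borel_measurable_of_real borel_measurable_const
        borel_measurable_uminus c)
  then have "(\<lambda>A. A $$ (i, j)) \<in> borel_measurable (embed_measure (coord_measure n) (herm_of_coords n))"
    by (rule measurable_embed_measure1)
  then show ?thesis
    unfolding Lambda_def by (simp cong: measurable_cong_sets)
qed

lemma space_Lambda_power:
  "space (Lambda_power n :: ('n :: finite \<Rightarrow> _) measure) = {A. \<forall>i. A i \<in> herm_mats n}"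
  by (auto simp: Lambda_power_def space_PiM space_Lambda PiE_def)

lemma measurable_word_mat_entry:
  assumes "i < n" "j < n"
  shows "(\<lambda>A. word_mat n A w $$ (i, j)) \<in>
    borel_measurable (Lambda_power n :: ('n :: finite \<Rightarrow> _) measure)"
  using assms
proof (induction w arbitrary: i j)
  case Nil
  then show ?case by (simp add: word_mat_def)
next
  case (Cons x w)
  let ?M = "Lambda_power n :: ('n \<Rightarrow> _) measure"
  have x: "(\<lambda>A. A x $$ (i, k)) \<in> borel_measurable ?M" if "k < n" for k
  proof -
    have "(\<lambda>A. A x) \<in> measurable ?M (Lambda n)"
      unfolding Lambda_power_def by (rule measurable_component_singleton) simp
    from measurable_compose[OF this measurable_Lambda_entry[OF Cons.prems(1) that]]
    show ?thesis .
  qed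
  have "(\<lambda>A. \<Sum>k<n. A x $$ (i, k) * word_mat n A w $$ (k, j)) \<in> borel_measurable ?M"
    using Cons.prems x by (intro borel_measurable_sum borel_measurable_times Cons.IH) auto
  moreover have "word_mat n A (x # w) $$ (i, j) =
      (\<Sum>k<n. A x $$ (i, k) * word_mat n A w $$ (k, j))" if "A \<in> space ?M" for A
    unfolding word_mat_Cons using that Cons.prems
    by (intro index_mult_mat_sum word_mat_carrier)
      (auto simp: space_Lambda_power herm_mats_def)
  ultimately show ?case
    by (simp cong: measurable_cong)
qed

lemma measurable_ntrace_word:
  "(\<lambda>A. ntrace n (word_mat n A w)) \<in>
    borel_measurable (Lambda_power n :: ('n :: finite \<Rightarrow> _) measure)"
  unfolding ntrace_def
  by (intro borel_measurable_divide borel_measurable_sum borel_measurable_const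
      measurable_word_mat_entry) auto

lemma finite_words: "finite {w :: 'n :: finite list. 1 \<le> length w \<and> length w \<le> r}"
  by (rule finite_subset[OF _ finite_lists_length_le[of UNIV r]]) auto

text \<open>Over a finite alphabet only finitely many words have length at most \<open>r\<close>.
  Since \<open>emeasure\<close> is 0 on nonmeasurable sets, monotonicity of the volumes depends on
  this.\<close>

lemma sets_microstates: "microstates R \<tau> a n r \<epsilon> \<in> sets (Lambda_power n)"
proof -
  let ?W = "{w :: 'a list. 1 \<le> length w \<and> length w \<le> r}"
  let ?M = "Lambda_power n :: ('a \<Rightarrow> _) measure"
  have "{A \<in> space ?M. cmod (ntrace n (word_mat n A w) - \<tau> (word_op a w)) \<le> \<epsilon>} \<in> sets ?M" for w
    using measurable_ntrace_word[of n w, measurable] by measurable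
  then have "{A \<in> space ?M. \<forall>w\<in>?W. cmod (ntrace n (word_mat n A w) - \<tau> (word_op a w)) \<le> \<epsilon>} \<in> sets ?M"
    by (intro sets.sets_Collect_finite_All finite_words)
  with sets_mat_ball have "mat_ball n R \<inter> {A \<in> space ?M.
      \<forall>w\<in>?W. cmod (ntrace n (word_mat n A w) - \<tau> (word_op a w)) \<le> \<epsilon>} \<in> sets ?M"
    by (rule sets.Int)
  also have "mat_ball n R \<inter> {A \<in> space ?M.
      \<forall>w\<in>?W. cmod (ntrace n (word_mat n A w) - \<tau> (word_op a w)) \<le> \<epsilon>} = microstates R \<tau> a n r \<epsilon>"
    by (auto simp: microstates_def space_Lambda_power mat_ball_def)
  finally show ?thesis .
qed

section \<open>Comparison of the entropies\<close>

lemma microstates_mono: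
  "\<lbrakk>r' \<le> r; \<epsilon> \<le> \<epsilon>'\<rbrakk> \<Longrightarrow> microstates R \<tau> a n r \<epsilon> \<subseteq> microstates R \<tau> a n r' \<epsilon>'"
  unfolding microstates_def by (auto intro: order_trans)

text \<open>Microstate sets shrink as \<open>r\<close> grows and \<epsilon> decreases, so the joint
  limit exists and is the infimum.\<close>

lemma chi_R_eq_INF:
  fixes a :: "'n :: finite \<Rightarrow> ('h :: complex_hilbert \<Rightarrow>\<^sub>L 'h)"
  shows "chi_R R \<tau> a = (INF (r, \<epsilon>)\<in>UNIV \<times> {0<..}.
    growth_rate CARD('n) (\<lambda>n. emeasure (Lambda_power n) (microstates R \<tau> a n r \<epsilon>)))"
proof -
  define F where "F r \<epsilon> =
    growth_rate CARD('n) (\<lambda>n. emeasure (Lambda_power n) (microstates R \<tau> a n r \<epsilon>))" for r \<epsilon>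
  let ?l = "INF (r, \<epsilon>)\<in>UNIV \<times> {0<..}. F r \<epsilon>"
  have mono: "F r \<epsilon> \<le> F r' \<epsilon>'" if "r' \<le> r" "\<epsilon> \<le> \<epsilon>'" for r r' \<epsilon> \<epsilon>'
    unfolding F_def using that
    by (intro growth_rate_mono always_eventually allI emeasure_mono microstates_mono
        sets_microstates)
  have pos: "eventually (\<lambda>\<epsilon> :: real. 0 < \<epsilon>) (at_right 0)"
    by (rule eventually_at_right_less)
  have "((\<lambda>(r, \<epsilon>). F r \<epsilon>) \<longlongrightarrow> ?l) (sequentially \<times>\<^sub>F at_right 0)"
  proof (rule order_tendstoI)
    fix l assume l: "l < ?l"
    \<comment> \<open>The infimum ranges over positive \<epsilon>, and bounds F from below only
      there.\<close>
    have "eventually (\<lambda>x. 0 < snd x) (sequentially \<times>\<^sub>F at_right (0 :: real))"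
      using eventually_prod2[of sequentially "\<lambda>\<epsilon>. 0 < \<epsilon>" "at_right (0 :: real)"] pos
      by (simp add: case_prod_unfold)
    then show "eventually (\<lambda>x. l < (case x of (r, \<epsilon>) \<Rightarrow> F r \<epsilon>)) (sequentially \<times>\<^sub>F at_right 0)"
    proof eventually_elim
      case (elim x)
      then have "?l \<le> (case x of (r, \<epsilon>) \<Rightarrow> F r \<epsilon>)"
        by (intro INF_lower) (auto simp: mem_Times_iff)
      with l show ?case by (rule less_le_trans)
    qed
  next
    fix l assume "?l < l"
    then obtain r0 \<epsilon>0 where 0: "0 < \<epsilon>0" "F r0 \<epsilon>0 < l"
      by (auto simp: INF_less_iff)
    have "eventually (\<lambda>\<epsilon>. \<epsilon> < \<epsilon>0) (at_right 0)"
      using 0(1) by (rule eventually_at_rightI[of 0 \<epsilon>0, rotated]) auto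
    then have "eventually (\<lambda>x. r0 \<le> fst x \<and> snd x < \<epsilon>0) (sequentially \<times>\<^sub>F at_right 0)"
      using eventually_prodI[OF eventually_ge_at_top[of r0]] by fastforce
    then show "eventually (\<lambda>x. (case x of (r, \<epsilon>) \<Rightarrow> F r \<epsilon>) < l) (sequentially \<times>\<^sub>F at_right 0)"
    proof eventually_elim
      case (elim x)
      then have "(case x of (r, \<epsilon>) \<Rightarrow> F r \<epsilon>) \<le> F r0 \<epsilon>0"
        by (auto simp: case_prod_unfold intro!: mono)
      then show ?case using 0(2) by (rule le_less_trans)
    qed
  qed
  \<comment> \<open>\<open>Lim\<close> picks out the limit only if it is unique, hence the
    nontrivial filter.\<close>
  moreover have "sequentially \<times>\<^sub>F at_right (0 :: real) \<noteq> bot"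
    by (simp add: prod_filter_eq_bot)
  ultimately show ?thesis
    unfolding chi_R_def F_def by (intro tendsto_Lim)
qed

section \<open>Microstate entropy against tensor pressure\<close>

context
  fixes \<tau> :: "('h :: complex_hilbert \<Rightarrow>\<^sub>L 'h) \<Rightarrow> complex"
    and a :: "'n :: finite \<Rightarrow> ('h \<Rightarrow>\<^sub>L 'h)"
  assumes unital: "\<tau> id_blinfun = 1"
begin

abbreviation moment :: "'n list \<Rightarrow> complex"
  where "moment w \<equiv> \<tau> (word_op a w)"

lemma moment_Nil: "moment [] = 1"
  by (simp add: word_op_def unital)

text \<open>On suitable microstates the integrand is at least e^(-n^2 (\<nu>(q) + \<delta>)).
  Restricting the integral to them bounds their volume by e^(n^2 (\<nu>(q) + \<delta>)) times the
  integral, and \<delta> is arbitrary.\<close>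

lemma chi_R_le_eta_tilde_R: "chi_R R \<tau> a \<le> eta_tilde_R R \<tau> a"
  unfolding eta_tilde_R_def eta2_R_def
proof (rule INF_greatest)
  fix q :: "'n ncpoly2"
  let ?\<nu> = "Re (lin_ext (tensor_word moment) q)"
  show "chi_R R \<tau> a \<le> ereal (Re (tensor_functional (distribution \<tau> a) (distribution \<tau> a) q)) +
      pressure2 R q"
    unfolding tensor_functional_lin_ext
  proof (rule ereal_le_epsilon2)
    fix \<delta> :: real assume \<delta>: "0 < \<delta>"
    obtain r \<epsilon> where \<epsilon>: "0 < \<epsilon>"
      and close: "\<forall>x. (\<forall>w. length w \<le> r \<longrightarrow> cmod (x w - moment w) \<le> \<epsilon>) \<longrightarrow>
        cmod (lin_ext (tensor_word x) q - lin_ext (tensor_word moment) q) \<le> \<delta>"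
      using lin_ext_tensor_word_continuous[OF \<delta>, of moment q] by blast
    have le: "Re (ntrace2_eval n q A) \<le> ?\<nu> + \<delta>"
      if n: "0 < n" and A: "A \<in> microstates R \<tau> a n r \<epsilon>" for n A
    proof -
      have "cmod (ntrace n (word_mat n A w) - moment w) \<le> \<epsilon>" if "length w \<le> r" for w
      proof (cases w)
        \<comment> \<open>Microstates constrain nonempty words only; for the empty word both moments
          are 1.\<close>
        case Nil
        with n \<epsilon> show ?thesis by (simp add: ntrace_word_Nil moment_Nil)
      next
        case Cons
        with A that show ?thesis by (auto simp: microstates_def)
      qed
      then have "cmod (ntrace2_eval n q A - lin_ext (tensor_word moment) q) \<le> \<delta>"
        unfolding ntrace2_eval_lin_ext by (intro close[rule_format]) simp
      then have "Re (ntrace2_eval n q A - lin_ext (tensor_word moment) q) \<le> \<delta>"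
        by (rule order_trans[OF complex_Re_le_cmod])
      then show ?thesis by simp
    qed
    let ?I = "\<lambda>n. \<integral>\<^sup>+A\<in>mat_ball n R. ennreal (exp (- (real n)\<^sup>2 * Re (ntrace2_eval n q A)))
      \<partial>Lambda_power n"
    let ?V = "\<lambda>n. emeasure (Lambda_power n) (microstates R \<tau> a n r \<epsilon>)"
    have "eventually (\<lambda>n. ?V n \<le> ennreal (exp ((real n)\<^sup>2 * (?\<nu> + \<delta>))) * ?I n) sequentially"
      using eventually_gt_at_top[of 0]
    proof eventually_elim
      case (elim n)
      let ?e = "\<lambda>c. ennreal (exp ((real n)\<^sup>2 * c))"
      have "?e (- (?\<nu> + \<delta>)) * ?V n =
          (\<integral>\<^sup>+A. ?e (- (?\<nu> + \<delta>)) * indicator (microstates R \<tau> a n r \<epsilon>) A \<partial>Lambda_power n)"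
        by (rule nn_integral_cmult_indicator[symmetric]) (rule sets_microstates)
      also have "\<dots> \<le> ?I n"
      proof (rule nn_integral_mono)
        fix A :: "'n \<Rightarrow> complex mat"
        show "?e (- (?\<nu> + \<delta>)) * indicator (microstates R \<tau> a n r \<epsilon>) A \<le>
            ennreal (exp (- (real n)\<^sup>2 * Re (ntrace2_eval n q A))) * indicator (mat_ball n R) A"
        proof (cases "A \<in> microstates R \<tau> a n r \<epsilon>")
          case True
          have "(real n)\<^sup>2 * (- (?\<nu> + \<delta>)) \<le> - (real n)\<^sup>2 * Re (ntrace2_eval n q A)"
            using mult_left_mono[OF le[OF elim True], of "(real n)\<^sup>2"]
            by (simp add: algebra_simps)
          then have "?e (- (?\<nu> + \<delta>)) \<le>
              ennreal (exp (- (real n)\<^sup>2 * Re (ntrace2_eval n q A)))"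
            by (intro ennreal_leI) (simp only: exp_le_cancel_iff)
          moreover have "A \<in> mat_ball n R" using True by (simp add: microstates_def)
          ultimately show ?thesis using True by simp
        qed simp
      qed
      finally have "?e (?\<nu> + \<delta>) * (?e (- (?\<nu> + \<delta>)) * ?V n) \<le> ?e (?\<nu> + \<delta>) * ?I n"
        by (rule mult_left_mono) simp
      moreover have "?e (?\<nu> + \<delta>) * (?e (- (?\<nu> + \<delta>)) * ?V n) = ?V n"
        by (simp add: mult.assoc[symmetric] ennreal_mult[symmetric] exp_add[symmetric]
            distrib_left[symmetric] del: mult_minus_right)
      ultimately show ?case by simp
    qed
    then have "growth_rate CARD('n) ?V \<le> ereal (?\<nu> + \<delta>) + pressure2 R q"
      unfolding pressure2_def by (rule growth_rate_le_exp)
    moreover have "chi_R R \<tau> a \<le> growth_rate CARD('n) ?V"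
      unfolding chi_R_eq_INF using \<epsilon> by (intro INF_lower2[of "(r, \<epsilon>)"]) auto
    ultimately show "chi_R R \<tau> a \<le> ereal ?\<nu> + pressure2 R q + ereal \<delta>"
      by (simp add: ac_simps flip: plus_ereal.simps(1))
  qed
qed

text \<open>The test polynomial \<open>q\<close> sums the deviations of all words up to length
  \<open>r\<close>. The ball splits into the microstates, where the integrand is at most 1, and the
  rest, where some word deviates by more than \<epsilon> and the integrand is at most e^(-2 K
  \<epsilon>^2 n^2).\<close>

lemma eta_tilde_R_le_max:
  assumes \<epsilon>: "0 < \<epsilon>" and K: "0 < K"
  shows "eta_tilde_R R \<tau> a \<le>
    max (growth_rate CARD('n) (\<lambda>n. emeasure (Lambda_power n) (microstates R \<tau> a n r \<epsilon>)))
      (ereal (real CARD('n) * (R\<^sup>2 / 2 + ln (2 * pi) / 2 + ln 2) - 2 * K * \<epsilon>\<^sup>2))"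
proof -
  let ?W = "{w :: 'n list. 1 \<le> length w \<and> length w \<le> r}"
  define q where "q = (\<Sum>w\<in>?W. deviation_poly K (moment w) w)"
  have q: "q \<in> ncpoly2_sa"
    unfolding q_def by (intro ncpoly2_sa_sum deviation_poly_sa)
  \<comment> \<open>Every deviation is centred at the moment of \<open>a\<close>, so the functional
    adds nothing and the pressure of \<open>q\<close> alone bounds the infimum.\<close>
  have \<nu>: "lin_ext (tensor_word moment) q = 0"
    by (simp add: q_def lin_ext_deviation_poly moment_Nil)
  have tr: "Re (ntrace2_eval n q A) =
      (\<Sum>w\<in>?W. 2 * K * (cmod (ntrace n (word_mat n A w) - moment w))\<^sup>2)"
    if n: "0 < n" and A: "A \<in> mat_ball n R" for n A
  proof -
    have "ntrace n (word_mat n A (rev w)) - cnj (moment w) =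
        cnj (ntrace n (word_mat n A w) - moment w)" for w
      using A by (simp add: mat_ball_def ntrace_word_rev)
    then have "ntrace2_eval n q A = (\<Sum>w\<in>?W. 2 * of_real K *
        ((ntrace n (word_mat n A w) - moment w) * cnj (ntrace n (word_mat n A w) - moment w)))"
      unfolding ntrace2_eval_lin_ext q_def
      by (simp add: lin_ext_deviation_poly ntrace_word_Nil n mult_ac del: complex_cnj_diff)
    also have "\<dots> = of_real (\<Sum>w\<in>?W. 2 * K * (cmod (ntrace n (word_mat n A w) - moment w))\<^sup>2)"
      by (simp only: of_real_sum of_real_mult of_real_numeral complex_norm_square)
    finally show ?thesis by (simp only: Re_complex_of_real)
  qed
  let ?V = "\<lambda>n. emeasure (Lambda_power n) (microstates R \<tau> a n r \<epsilon>)"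
  let ?B = "\<lambda>n. emeasure (Lambda_power n) (mat_ball n R :: ('n \<Rightarrow> _) set)"
  let ?e = "\<lambda>n :: nat. ennreal (exp ((real n)\<^sup>2 * (- (2 * K * \<epsilon>\<^sup>2))))"
  have bound: "ennreal (exp (- (real n)\<^sup>2 * Re (ntrace2_eval n q A))) * indicator (mat_ball n R) A \<le>
      indicator (microstates R \<tau> a n r \<epsilon>) A + ?e n * indicator (mat_ball n R) A"
    if n: "0 < n" for n A
  proof (cases "A \<in> mat_ball n R")
    case True
    have nonneg: "0 \<le> Re (ntrace2_eval n q A)"
      unfolding tr[OF n True] using K by (intro sum_nonneg) simp
    show ?thesis
    proof (cases "A \<in> microstates R \<tau> a n r \<epsilon>")
      case mic: True
      have "ennreal (exp (- (real n)\<^sup>2 * Re (ntrace2_eval n q A))) \<le> 1"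
        using nonneg by simp
      with True mic show ?thesis by (simp add: add_increasing2)
    next
      case False
      \<comment> \<open>A single violated word is enough, because the other summands are
        nonnegative.\<close>
      with True obtain w where w: "w \<in> ?W"
        and "\<not> cmod (ntrace n (word_mat n A w) - moment w) \<le> \<epsilon>"
        by (auto simp: microstates_def)
      then have "2 * K * \<epsilon>\<^sup>2 \<le> 2 * K * (cmod (ntrace n (word_mat n A w) - moment w))\<^sup>2"
        using K \<epsilon> by (intro mult_left_mono power_mono) auto
      also have "\<dots> \<le> Re (ntrace2_eval n q A)"
        unfolding tr[OF n True] using K finite_words
        by (intro member_le_sum[OF w, where f = "\<lambda>w. 2 * K * (cmod (ntrace n (word_mat n A w) - moment w))\<^sup>2"]) auto
      finally have "2 * K * \<epsilon>\<^sup>2 \<le> Re (ntrace2_eval n q A)" .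
      from mult_left_mono[OF this, of "(real n)\<^sup>2"]
      have "- (real n)\<^sup>2 * Re (ntrace2_eval n q A) \<le> (real n)\<^sup>2 * (- (2 * K * \<epsilon>\<^sup>2))"
        by simp
      then have "ennreal (exp (- (real n)\<^sup>2 * Re (ntrace2_eval n q A))) \<le> ?e n"
        by (intro ennreal_leI) (simp only: exp_le_cancel_iff)
      with True False show ?thesis by simp
    qed
  qed simp
  let ?C = "real CARD('n) * (R\<^sup>2 / 2 + ln (2 * pi) / 2 + ln 2)"
  have "growth_rate CARD('n) (\<lambda>n. ?e n * ?B n) \<le>
      ereal (- (2 * K * \<epsilon>\<^sup>2)) + growth_rate CARD('n) ?B"
    by (rule growth_rate_le_exp) simp
  also have "\<dots> \<le> ereal (- (2 * K * \<epsilon>\<^sup>2)) + ereal ?C"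
    by (intro add_left_mono growth_rate_mat_ball)
  finally have ball: "growth_rate CARD('n) (\<lambda>n. ?e n * ?B n) \<le> ereal (?C - 2 * K * \<epsilon>\<^sup>2)"
    by simp
  have "eta_tilde_R R \<tau> a \<le> ereal 0 + pressure2 R q"
    unfolding eta_tilde_R_def eta2_R_def using q
    by (intro INF_lower2[of q]) (simp_all add: tensor_functional_lin_ext \<nu>)
  also have "\<dots> = pressure2 R q" by (simp flip: zero_ereal_def)
  also have "\<dots> \<le> growth_rate CARD('n) (\<lambda>n. ?V n + ?e n * ?B n)"
    unfolding pressure2_def
  proof (rule growth_rate_mono)
    show "eventually (\<lambda>n. (\<integral>\<^sup>+A\<in>mat_ball n R. ennreal (exp (- (real n)\<^sup>2 * Re (ntrace2_eval n q A)))
      \<partial>Lambda_power n) \<le> ?V n + ?e n * ?B n) sequentially"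
      using eventually_gt_at_top[of 0]
    proof eventually_elim
      case (elim n)
      have "(\<integral>\<^sup>+A\<in>mat_ball n R. ennreal (exp (- (real n)\<^sup>2 * Re (ntrace2_eval n q A)))
          \<partial>Lambda_power n) \<le> (\<integral>\<^sup>+A. indicator (microstates R \<tau> a n r \<epsilon>) A +
          ?e n * indicator (mat_ball n R) A \<partial>Lambda_power n)"
        by (intro nn_integral_mono bound elim)
      also have "\<dots> = ?V n + ?e n * ?B n"
        using sets_microstates[of R \<tau> a n r \<epsilon>] sets_mat_ball[of n R, where 'n = 'n]
        by (subst nn_integral_add) (auto simp: nn_integral_cmult_indicator)
      finally show ?case .
    qed
  qed
  also have "\<dots> \<le> max (growth_rate CARD('n) ?V) (growth_rate CARD('n) (\<lambda>n. ?e n * ?B n))"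
    by (rule growth_rate_add)
  also have "\<dots> \<le> max (growth_rate CARD('n) ?V) (ereal (?C - 2 * K * \<epsilon>\<^sup>2))"
    by (rule max.mono[OF order_refl ball])
  finally show ?thesis .
qed

text \<open>The microstate rate may be -\<infinity>, and then no fixed K brings the second term of
  the maximum below it; K is therefore chosen for each real c above the rate.\<close>

lemma eta_tilde_R_le_chi_R: "eta_tilde_R R \<tau> a \<le> chi_R R \<tau> a"
  unfolding chi_R_eq_INF
proof (rule INF_greatest, clarify)
  fix r and \<epsilon> :: real assume "0 < \<epsilon>"
  let ?g = "growth_rate CARD('n) (\<lambda>n. emeasure (Lambda_power n) (microstates R \<tau> a n r \<epsilon>))"
  let ?C = "real CARD('n) * (R\<^sup>2 / 2 + ln (2 * pi) / 2 + ln 2)"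
  show "eta_tilde_R R \<tau> a \<le> ?g"
  proof (rule ereal_le_if_real)
    fix c assume c: "?g < ereal c"
    \<comment> \<open>Solves ?C - 2 K \<epsilon>^2 \<le> c for K; the maximum with 1 keeps K
      positive.\<close>
    define K where "K = max 1 ((?C - c) / (2 * \<epsilon>\<^sup>2))"
    have "(?C - c) / (2 * \<epsilon>\<^sup>2) \<le> K" by (simp add: K_def)
    then have "?C - 2 * K * \<epsilon>\<^sup>2 \<le> c"
      using \<open>0 < \<epsilon>\<close> by (simp add: pos_divide_le_eq algebra_simps)
    moreover have "0 < K" by (simp add: K_def)
    ultimately show "eta_tilde_R R \<tau> a \<le> ereal c"
      using eta_tilde_R_le_max[OF \<open>0 < \<epsilon>\<close>, of K R r] c
      by (smt (verit) ereal_less_eq(3) less_imp_le max.bounded_iff order_trans)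
  qed
qed

end

text \<open>The second leg contributes tr_n(1) = 1, which fails for n = 0; the integrals are thus
  compared eventually, in both directions.\<close>

lemma pressure2_tensor_one: "pressure2 R (tensor_one p) = pressure R p"
proof -
  have eq: "ntrace2_eval n (tensor_one p) A = ntrace n (eval_mat n p A)" if "0 < n" for n A
    unfolding ntrace2_eval_lin_ext ntrace_eval_mat
    by (rule lin_ext_tensor_one) (rule ntrace_word_Nil[OF that])
  show ?thesis
    unfolding pressure2_def pressure_def
    by (intro antisym growth_rate_mono)
      (auto intro!: eventually_mono[OF eventually_gt_at_top[of 0]] simp: eq)
qed

section \<open>Algebra operations inside a von Neumann algebra\<close>

lemma blinfun_eq_iff: "A = B \<longleftrightarrow> (\<forall>x. blinfun_apply A x = blinfun_apply B x)"
  by (metis blinfun_eqI)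

lemma commutantI:
  assumes "\<And>c x. blinfun_apply A (c *\<^sub>C x) = c *\<^sub>C blinfun_apply A x"
    and "\<And>X x. X \<in> S \<Longrightarrow> blinfun_apply A (blinfun_apply X x) = blinfun_apply X (blinfun_apply A x)"
  shows "A \<in> commutant S"
  unfolding commutant_def bounded_ops_def using assms by (auto simp: blinfun_eq_iff)

lemma commutant_commute:
  assumes "A \<in> commutant S" "X \<in> S"
  shows "blinfun_apply A (blinfun_apply X x) = blinfun_apply X (blinfun_apply A x)"
proof -
  have "A o\<^sub>L X = X o\<^sub>L A"
    using assms unfolding commutant_def by blast
  from arg_cong[OF this, of "\<lambda>T. blinfun_apply T x"] show ?thesis
    by (simp only: blinfun_apply_blinfun_compose)
qed

lemma commutant_scaleC:
  "A \<in> commutant S \<Longrightarrow> blinfun_apply A (c *\<^sub>C x) = c *\<^sub>C blinfun_apply A x"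
  by (simp add: commutant_def bounded_ops_def)

lemma id_blinfun_commutant: "id_blinfun \<in> commutant S"
  by (rule commutantI) simp_all

lemma add_commutant: "\<lbrakk>A \<in> commutant S; B \<in> commutant S\<rbrakk> \<Longrightarrow> A + B \<in> commutant S"
  by (rule commutantI)
    (simp_all add: blinfun.add_left blinfun.add_right commutant_scaleC commutant_commute
      scaleC_add_right)

lemma compose_commutant: "\<lbrakk>A \<in> commutant S; B \<in> commutant S\<rbrakk> \<Longrightarrow> A o\<^sub>L B \<in> commutant S"
  by (rule commutantI) (simp_all add: commutant_scaleC commutant_commute)

text \<open>A complex scalar passes through an element of \<open>S\<close> only if that element is
  complex-linear, hence the inclusion in \<open>bounded_ops\<close>.\<close>

lemma scale_op_commutant:
  assumes A: "A \<in> commutant S" and S: "S \<subseteq> bounded_ops"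
  shows "scale_op c A \<in> commutant S"
proof (rule commutantI)
  show "blinfun_apply (scale_op c A) (d *\<^sub>C x) = d *\<^sub>C blinfun_apply (scale_op c A) x" for d x
    by (simp add: scale_op.rep_eq commutant_scaleC[OF A] scaleC_scaleC mult.commute)
  fix X x assume X: "X \<in> S"
  with S have "blinfun_apply X (d *\<^sub>C y) = d *\<^sub>C blinfun_apply X y" for d y
    by (auto simp: bounded_ops_def)
  then show "blinfun_apply (scale_op c A) (blinfun_apply X x) =
      blinfun_apply X (blinfun_apply (scale_op c A) x)"
    by (simp add: scale_op.rep_eq commutant_commute[OF A X])
qed

context tracial_W_star_probability_space
begin

text \<open>Exhibits M as a commutant, from which it inherits all algebra operations.\<close>

lemma commutant_commutant: "commutant (commutant M) = M"
  using von_neumann by (simp add: von_neumann_algebra_def)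

lemma id_mem: "id_blinfun \<in> M"
  using id_blinfun_commutant[of "commutant M"] by (simp add: commutant_commutant)

lemma add_mem: "\<lbrakk>A \<in> M; B \<in> M\<rbrakk> \<Longrightarrow> A + B \<in> M"
  using add_commutant[of A "commutant M" B] by (simp add: commutant_commutant)

lemma compose_mem: "\<lbrakk>A \<in> M; B \<in> M\<rbrakk> \<Longrightarrow> A o\<^sub>L B \<in> M"
  using compose_commutant[of A "commutant M" B] by (simp add: commutant_commutant)

lemma scale_op_mem: "A \<in> M \<Longrightarrow> scale_op c A \<in> M"
  using scale_op_commutant[of A "commutant M" c]
  by (simp add: commutant_commutant) (auto simp: commutant_def)

lemma word_op_mem: "(\<And>i. a i \<in> M) \<Longrightarrow> word_op a w \<in> M"
  by (induction w) (simp_all add: word_op_def id_mem compose_mem)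

text \<open>The trace is additive on M only, so membership and value are carried through the
  induction together.\<close>

lemma sum_scale_op:
  assumes f: "\<And>x. f x \<in> M"
  shows "(\<Sum>x\<in>S. scale_op (c x) (f x)) \<in> M \<and>
    \<tau> (\<Sum>x\<in>S. scale_op (c x) (f x)) = (\<Sum>x\<in>S. c x * \<tau> (f x))"
proof -
  have zero: "scale_op 0 id_blinfun = 0"
    using scaleC_of_real[of 0] by (auto simp: blinfun_eq_iff scale_op.rep_eq)
  have zero_mem: "0 \<in> M \<and> \<tau> 0 = 0"
    using scale_op_mem[OF id_mem, of 0] scale[OF id_mem, of 0] unfolding zero by simp
  show ?thesis
  proof (induction S rule: infinite_finite_induct)
    case (insert x S)
    have "scale_op (c x) (f x) \<in> M" "\<tau> (scale_op (c x) (f x)) = c x * \<tau> (f x)"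
      using scale_op_mem[OF f] scale[OF f] by simp_all
    then show ?case
      using insert add_mem add[of "scale_op (c x) (f x)" "\<Sum>x\<in>S. scale_op (c x) (f x)"] by simp
  qed (simp_all add: zero_mem)
qed

text \<open>\<open>tensor_one p\<close> has the same pressure as p and the same value, by linearity
  of \<tau> on M, so the infimum for \<open>eta_tilde_R\<close> runs over at least as many
  tests.\<close>

lemma eta_tilde_R_le_eta_R:
  fixes a :: "'n :: finite \<Rightarrow> ('h \<Rightarrow>\<^sub>L 'h)"
  assumes a: "\<And>i. a i \<in> M"
  shows "eta_tilde_R R \<tau> a \<le> eta_R R \<tau> a"
  unfolding eta_R_def
proof (rule INF_greatest)
  fix p :: "'n ncpoly" assume p: "p \<in> ncpoly_sa"
  have "\<tau> (eval_op p a) = lin_ext (\<lambda>w. \<tau> (word_op a w)) p"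
    unfolding eval_op_def lin_ext_def
    using sum_scale_op[of "word_op a"] word_op_mem[of a] a by simp
  also have "\<dots> = tensor_functional (distribution \<tau> a) (distribution \<tau> a) (tensor_one p)"
    unfolding tensor_functional_lin_ext
    by (rule lin_ext_tensor_one[symmetric]) (simp add: word_op_def unital)
  finally show "eta_tilde_R R \<tau> a \<le> ereal (Re (\<tau> (eval_op p a))) + pressure R p"
    unfolding eta_tilde_R_def eta2_R_def
    using tensor_one_sa[OF p] by (intro INF_lower2[of "tensor_one p"]) (simp_all add: pressure2_tensor_one)
qed

end

theorem theorem6p4:
  fixes M :: "('h :: complex_hilbert \<Rightarrow>\<^sub>L 'h) set"
    and \<tau> :: "('h \<Rightarrow>\<^sub>L 'h) \<Rightarrow> complex"
    and a :: "'n :: finite \<Rightarrow> ('h \<Rightarrow>\<^sub>L 'h)"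
  assumes "tracial_W_star_probability_space M \<tau>"
    and "\<And>i. a i \<in> selfadjoints M"
  shows "(\<forall>R>0. eta_R R \<tau> a \<ge> eta_tilde_R R \<tau> a \<and> eta_tilde_R R \<tau> a = chi_R R \<tau> a) \<and>
    eta \<tau> a \<ge> eta_tilde \<tau> a \<and> eta_tilde \<tau> a = chi \<tau> a"
proof -
  interpret tracial_W_star_probability_space M \<tau> by fact
  have a: "a i \<in> M" for i
    using assms(2) by (simp add: selfadjoints_def)
  have le: "eta_tilde_R R \<tau> a \<le> eta_R R \<tau> a" for R
    using a by (rule eta_tilde_R_le_eta_R)
  have eq: "eta_tilde_R R \<tau> a = chi_R R \<tau> a" for R
    using eta_tilde_R_le_chi_R[of \<tau>, OF unital] chi_R_le_eta_tilde_R[of \<tau>, OF unital]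
    by (rule antisym)
  have "eta_tilde \<tau> a \<le> eta \<tau> a"
    unfolding eta_tilde_def eta_def by (intro SUP_mono) (auto intro: le)
  moreover have "eta_tilde \<tau> a = chi \<tau> a"
    unfolding eta_tilde_def chi_def by (simp add: eq)
  ultimately show ?thesis using le eq by blast
qed

end
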